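(* Suppose Assumption A (constant $d$), Assumption E and Assumption O hold, and let $\epsilon_\theta\in(0,1)$ be such that $m^\circ_\epsilon\le G_\epsilon$ for all $\epsilon\in(0,\epsilon_\theta)$. If in addition $\log(G_\epsilon/\Phi^\circ_\epsilon)/m^\circ_\epsilon\to0$ as $\epsilon\to0$, then there exists a constant $K<\infty$ depending only on $\theta^\circ,\eta,\lambda,d$ such that the Bayes estimator $\hat\theta=\mathbb E[\vartheta^M|Y]$ satisfies $\mathbb E_{\theta^\circ}\|\hat\theta-\theta^\circ\|^2\le K\,\Phi^\circ_\epsilon$ for all $\epsilon\in(0,\epsilon_\theta)$.
   Context: Let $\ell^2$ be the space of square-summable real sequences with norm $\|\cdot\|$. Fix a bounded real sequence $\lambda=(\lambda_j)_{j\ge1}$ with $\lambda_j\ne0$ for all $j$, a noise level $\epsilon\in(0,1)$ and a true parameter $\theta^\circ\in\ell^2$. The data $Y=(Y_j)_{j\ge1}$ satisfy $Y_j=\lambda_j\theta^\circ_j+\sqrt\epsilon\,\xi_j$ with $\xi_j$ i.i.d. $N(0,1)$; $\mathbb E_{\theta^\circ}$ denotes expectation under this law. Fix prior means $\eta=(\eta_j)_{j\ge1}$ with $\theta^\circ-\eta\in\ell^2$ and prior variances $\tau_j\in(0,\infty)$ (possibly depending on $\epsilon$). Put $\sigma_j:=(\lambda_j^2\epsilon^{-1}+\tau_j^{-1})^{-1}$, $\theta^Y_j:=\sigma_j(\tau_j^{-1}\eta_j+\lambda_j\epsilon^{-1}Y_j)$, $\hat\theta^m_j:=\theta^Y_j$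 for $j\le m$, $\hat\theta^m_j:=\eta_j$ for $j>m$. Define $b_m:=\sum_{j>m}(\theta^\circ_j-\eta_j)^2$, $\Lambda_j:=\lambda_j^{-2}$, $\Lambda_{(m)}:=\max_{1\le j\le m}\Lambda_j$, $\bar\Lambda_m:=m^{-1}\sum_{j=1}^m\Lambda_j$, $\Phi^m_\epsilon:=b_m\vee\epsilon m\bar\Lambda_m$, $m^\circ_\epsilon:=\min\{m\ge1:\Phi^m_\epsilon\le\Phi^k_\epsilon\ \forall k\ge1\}$, $\Phi^\circ_\epsilon:=\min_{m\ge1}\Phi^m_\epsilon$. Let $G_\epsilon:=\max\{1\le m\le\lfloor\epsilon^{-1}\rfloor:\epsilon\Lambda_{(m)}\le\Lambda_1\}$. Assumption A: there is $d>0$ with $\tau_j\ge d\,(\epsilon^{1/2}\Lambda_j^{1/2}\vee\epsilon\Lambda_j)$ for all $1\le j\le G_\epsilon$, $\epsilon\in(0,1)$. Assumption E: there are constants $C_\lambda\ge1$, $L_\lambda\ge1$ such that for all $k,l\in\mathbb N$: (i) $\sup_{j>k}\lambda_j^2\le C_\lambda\min_{1\le j\le k}\lambda_j^2=C_\lambda\Lambda_{(k)}^{-1}$; (ii) $\Lambda_{(kl)}\le\Lambda_{(k)}\Lambda_{(l)}$; (iii) $\Lambda_{(k)}/\bar\Lambda_k\le L_\lambda$. Fix $\epsilon_o\in(0,1)$. Assumption O: $\kappa^\circ:=\inf_{0<\epsilon<\epsilon_o}(\Phi^\circ_\epsilon)^{-1}[b_{m^\circ_\epsilon}\wedge\epsilon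 m^\circ_\epsilon\bar\Lambda_{m^\circ_\epsilon}]>0$. Hierarchical prior: a random dimension $M$ with values in $\{1,\dots,G_\epsilon\}$ and $P(M=m)\propto\exp(-3C_\lambda m/2)\prod_{j=1}^m(\tau_j/\sigma_j)^{1/2}$; conditionally on $M=m$ the parameter $\vartheta^M$ has independent coordinates $N(\eta_j,\tau_j)$ for $j\le m$ and equal to $\eta_j$ for $j>m$, and $Y_j=\lambda_j\vartheta^M_j+\sqrt\epsilon\xi_j$. The posterior of $M$ is $P_{M|Y}(M=m)=\exp(\frac12\{\|\hat\theta^m-\eta\|_\sigma^2-3C_\lambda m\})/\sum_{k=1}^{G_\epsilon}\exp(\frac12\{\|\hat\theta^k-\eta\|_\sigma^2-3C_\lambda k\})$ with $\|x\|_\sigma^2:=\sum_j x_j^2/\sigma_j$. The Bayes estimator $\hat\theta:=\mathbb E[\vartheta^M|Y]$ is given by $\hat\theta_j=\eta_j P_{M|Y}(1\le M<j)+\theta^Y_jP_{M|Y}(j\le M\le G_\epsilon)$ for $1\le j\le G_\epsilon$ and $\hat\theta_j=\eta_j$ for $j>G_\epsilon$. *)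

theory Defs
  imports "HOL-Probability.Probability"
begin

text \<open>Sequences are functions nat => real indexed from 1; the value at index 0 is ignored.\<close>

definition Lam :: "(nat \<Rightarrow> real) \<Rightarrow> nat \<Rightarrow> real" where
  "Lam lam j = 1 / (lam j)^2"

definition LamMax :: "(nat \<Rightarrow> real) \<Rightarrow> nat \<Rightarrow> real" where
  "LamMax lam m = Max (Lam lam ` {1..m})"

definition LamBar :: "(nat \<Rightarrow> real) \<Rightarrow> nat \<Rightarrow> real" where
  "LamBar lam m = (\<Sum>j=1..m. Lam lam j) / real m"

definition bias :: "(nat \<Rightarrow> real) \<Rightarrow> (nat \<Rightarrow> real) \<Rightarrow> nat \<Rightarrow> real" where
  "bias th eta m = (\<Sum>i. (th (i + m + 1) - eta (i + m + 1))^2)"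

definition Phi :: "(nat \<Rightarrow> real) \<Rightarrow> (nat \<Rightarrow> real) \<Rightarrow> (nat \<Rightarrow> real) \<Rightarrow> real \<Rightarrow> nat \<Rightarrow> real" where
  "Phi lam th eta eps m = max (bias th eta m) (eps * real m * LamBar lam m)"

definition mopt :: "(nat \<Rightarrow> real) \<Rightarrow> (nat \<Rightarrow> real) \<Rightarrow> (nat \<Rightarrow> real) \<Rightarrow> real \<Rightarrow> nat" where
  "mopt lam th eta eps = (LEAST m. 1 \<le> m \<and> (\<forall>k\<ge>1. Phi lam th eta eps m \<le> Phi lam th eta eps k))"

definition Phiopt :: "(nat \<Rightarrow> real) \<Rightarrow> (nat \<Rightarrow> real) \<Rightarrow> (nat \<Rightarrow> real) \<Rightarrow> real \<Rightarrow> real" where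
  "Phiopt lam th eta eps = (INF m\<in>{1..}. Phi lam th eta eps m)"

definition Gdim :: "(nat \<Rightarrow> real) \<Rightarrow> real \<Rightarrow> nat" where
  "Gdim lam eps = Max {m \<in> {1..nat \<lfloor>1 / eps\<rfloor>}. eps * LamMax lam m \<le> Lam lam 1}"

definition sq_norm :: "(nat \<Rightarrow> real) \<Rightarrow> real" where
  "sq_norm x = (\<Sum>i. (x (Suc i))^2)"

definition in_l2 :: "(nat \<Rightarrow> real) \<Rightarrow> bool" where
  "in_l2 x \<longleftrightarrow> summable (\<lambda>i. (x (Suc i))^2)"

definition sigma :: "(nat \<Rightarrow> real) \<Rightarrow> (real \<Rightarrow> nat \<Rightarrow> real) \<Rightarrow> real \<Rightarrow> nat \<Rightarrow> real" where
  "sigma lam tau eps j = 1 / ((lam j)^2 / eps + 1 / tau eps j)"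

definition thetaY :: "(nat \<Rightarrow> real) \<Rightarrow> (nat \<Rightarrow> real) \<Rightarrow> (real \<Rightarrow> nat \<Rightarrow> real) \<Rightarrow> real
    \<Rightarrow> (nat \<Rightarrow> real) \<Rightarrow> nat \<Rightarrow> real" where
  "thetaY lam eta tau eps Y j = sigma lam tau eps j * (eta j / tau eps j + lam j * Y j / eps)"

definition thetahat_m :: "(nat \<Rightarrow> real) \<Rightarrow> (nat \<Rightarrow> real) \<Rightarrow> (real \<Rightarrow> nat \<Rightarrow> real) \<Rightarrow> real
    \<Rightarrow> nat \<Rightarrow> (nat \<Rightarrow> real) \<Rightarrow> nat \<Rightarrow> real" where
  "thetahat_m lam eta tau eps m Y j = (if j \<le> m then thetaY lam eta tau eps Y j else eta j)"

definition sigma_norm_sq :: "(nat \<Rightarrow> real) \<Rightarrow> (real \<Rightarrow> nat \<Rightarrow> real) \<Rightarrow> real \<Rightarrow> (nat \<Rightarrow> real) \<Rightarrow> real" where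
  "sigma_norm_sq lam tau eps x = (\<Sum>i. (x (Suc i))^2 / sigma lam tau eps (Suc i))"

definition post_weight :: "(nat \<Rightarrow> real) \<Rightarrow> (nat \<Rightarrow> real) \<Rightarrow> (real \<Rightarrow> nat \<Rightarrow> real) \<Rightarrow> real \<Rightarrow> real
    \<Rightarrow> (nat \<Rightarrow> real) \<Rightarrow> nat \<Rightarrow> real" where
  "post_weight lam eta tau eps C Y m =
     exp ((sigma_norm_sq lam tau eps (\<lambda>j. thetahat_m lam eta tau eps m Y j - eta j) - 3 * C * real m) / 2)"

definition post :: "(nat \<Rightarrow> real) \<Rightarrow> (nat \<Rightarrow> real) \<Rightarrow> (real \<Rightarrow> nat \<Rightarrow> real) \<Rightarrow> real \<Rightarrow> real
    \<Rightarrow> (nat \<Rightarrow> real) \<Rightarrow> nat \<Rightarrow> real" where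
  "post lam eta tau eps C Y m =
     post_weight lam eta tau eps C Y m / (\<Sum>k=1..Gdim lam eps. post_weight lam eta tau eps C Y k)"

definition bayes_est :: "(nat \<Rightarrow> real) \<Rightarrow> (nat \<Rightarrow> real) \<Rightarrow> (real \<Rightarrow> nat \<Rightarrow> real) \<Rightarrow> real \<Rightarrow> real
    \<Rightarrow> (nat \<Rightarrow> real) \<Rightarrow> nat \<Rightarrow> real" where
  "bayes_est lam eta tau eps C Y j =
     (if j \<le> Gdim lam eps
      then eta j * (\<Sum>m\<in>{1..<j}. post lam eta tau eps C Y m)
           + thetaY lam eta tau eps Y j * (\<Sum>m\<in>{j..Gdim lam eps}. post lam eta tau eps C Y m)
      else eta j)"

definition obs :: "(nat \<Rightarrow> real) \<Rightarrow> (nat \<Rightarrow> real) \<Rightarrow> real \<Rightarrow> (nat \<Rightarrow> real) \<Rightarrow> nat \<Rightarrow> real" where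
  "obs lam th eps xi j = lam j * th j + sqrt eps * xi j"

definition noise :: "(nat \<Rightarrow> real) measure" where
  "noise = PiM UNIV (\<lambda>_. density lborel std_normal_density)"

definition risk :: "(nat \<Rightarrow> real) \<Rightarrow> (nat \<Rightarrow> real) \<Rightarrow> (nat \<Rightarrow> real) \<Rightarrow> (real \<Rightarrow> nat \<Rightarrow> real) \<Rightarrow> real
    \<Rightarrow> real \<Rightarrow> ennreal" where
  "risk lam th eta tau C eps =
     (\<integral>\<^sup>+ xi. ennreal (sq_norm (\<lambda>j. bayes_est lam eta tau eps C (obs lam th eps xi) j - th j)) \<partial>noise)"

definition assumpA :: "(nat \<Rightarrow> real) \<Rightarrow> (real \<Rightarrow> nat \<Rightarrow> real) \<Rightarrow> real \<Rightarrow> bool" where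
  "assumpA lam tau d \<longleftrightarrow> d > 0 \<and>
     (\<forall>eps\<in>{0<..<1}. \<forall>j\<in>{1..Gdim lam eps}.
        tau eps j \<ge> d * max (sqrt eps * sqrt (Lam lam j)) (eps * Lam lam j))"

definition assumpE :: "(nat \<Rightarrow> real) \<Rightarrow> real \<Rightarrow> real \<Rightarrow> bool" where
  "assumpE lam C L \<longleftrightarrow> C \<ge> 1 \<and> L \<ge> 1 \<and>
     (\<forall>k\<ge>1. \<forall>l\<ge>1.
        (\<forall>j>k. (lam j)^2 \<le> C * (Min ((\<lambda>i. (lam i)^2) ` {1..k}))) \<and>
        Min ((\<lambda>i. (lam i)^2) ` {1..k}) = 1 / LamMax lam k \<and>
        LamMax lam (k * l) \<le> LamMax lam k * LamMax lam l \<and>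
        LamMax lam k / LamBar lam k \<le> L)"

definition assumpO :: "(nat \<Rightarrow> real) \<Rightarrow> (nat \<Rightarrow> real) \<Rightarrow> (nat \<Rightarrow> real) \<Rightarrow> real \<Rightarrow> bool" where
  "assumpO lam th eta eps_o \<longleftrightarrow>
     (INF eps\<in>{0<..<eps_o}. inverse (Phiopt lam th eta eps) *
        min (bias th eta (mopt lam th eta eps))
            (eps * real (mopt lam th eta eps) * LamBar lam (mopt lam th eta eps))) > 0"

end

theory Submission
  imports Defs
begin

text \<open>
  After rescaling, the posterior weight of \<open>m\<close> is \<open>exp ((\<Sum>j\<le>m. s j * (a j + xi j)\<^sup>2 - 3 * C * m) / 2)\<close>
  with shrinkage factors \<open>s j \<in> [d / (1 + d), 1]\<close> and signal \<open>a j = lam j * (th j - eta j) / sqrt eps\<close>.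
  The posterior probability of \<open>m\<close> is bounded by its ratio to the weight of the oracle dimension \<open>mo\<close>,
  or by any fractional power of that ratio, and Gaussian exponential moments show that all dimensions
  outside a window \<open>[gm, R * mo]\<close> carry expected mass exponentially small in \<open>mo\<close>: below \<open>gm\<close>
  because the missed bias dominates the penalty, above \<open>R * mo\<close> because the penalty dominates the noise
  and the remaining signal, which Assumption O bounds by a multiple of \<open>mo\<close>.
  Inside the window the risk is of oracle order by Assumption E.
  The limit hypothesis makes \<open>Gdim * exp (- mo)\<close> at most \<open>Phiopt\<close> for small \<open>eps\<close>,
  which absorbs the outside mass; for \<open>eps\<close> bounded away from zero a crude bound suffices.
\<close>

subsection \<open>Gaussian white noise\<close>

lemma noise_prob_space: "prob_space noise"
  unfolding noise_def by (intro prob_space_PiM prob_space_normal_density) simp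

lemma sets_noise [measurable_cong]: "sets noise = sets (PiM UNIV (\<lambda>_. borel))"
  unfolding noise_def by (intro sets_PiM_cong) auto

lemma noise_component_measurable [measurable]: "(\<lambda>x. x j) \<in> borel_measurable noise"
  by measurable

lemma distr_noise_component:
  "distr noise borel (\<lambda>x. x j) = density lborel std_normal_density"
proof -
  have "distr noise borel (\<lambda>x. x j) = distr noise (density lborel std_normal_density) (\<lambda>x. x j)"
    by (intro distr_cong) auto
  also have "\<dots> = density lborel std_normal_density"
    unfolding noise_def
    by (intro distr_PiM_component prob_space_normal_density) auto
  finally show ?thesis .
qed

text \<open>A product measure is the product of its own marginals, which is the criterion for
  independence of the coordinates.\<close>

lemma indep_vars_noise: "prob_space.indep_vars noise (\<lambda>_. borel) (\<lambda>j x. x j) UNIV"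
proof -
  interpret prob_space noise by (rule noise_prob_space)
  have "distr noise (PiM UNIV (\<lambda>_. borel)) (\<lambda>x. \<lambda>i\<in>UNIV. x i) = distr noise noise (\<lambda>x. x)"
    by (intro distr_cong) (auto simp: sets_noise)
  also have "\<dots> = PiM UNIV (\<lambda>j. distr noise borel (\<lambda>x. x j))"
    unfolding distr_noise_component by (simp add: distr_id noise_def)
  finally show ?thesis
    by (subst indep_vars_iff_distr_eq_PiM) auto
qed

lemma nn_integral_noise_component:
  fixes f :: "real \<Rightarrow> real"
  assumes [measurable]: "f \<in> borel_measurable borel"
  shows "(\<integral>\<^sup>+ x. f (x j) \<partial>noise) = (\<integral>\<^sup>+ t. std_normal_density t * f t \<partial>lborel)"
proof -
  have "(\<integral>\<^sup>+ x. f (x j) \<partial>noise) = (\<integral>\<^sup>+ t. f t \<partial>distr noise borel (\<lambda>x. x j))"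
    by (subst nn_integral_distr) auto
  also have "\<dots> = (\<integral>\<^sup>+ t. std_normal_density t * f t \<partial>lborel)"
    by (simp add: distr_noise_component nn_integral_density ennreal_mult' normal_density_nonneg)
  finally show ?thesis .
qed

text \<open>Independence reduces exponential moments of weighted sums of squares to one-dimensional
  Gaussian integrals.\<close>

lemma nn_integral_noise_prod:
  fixes f :: "nat \<Rightarrow> real \<Rightarrow> real"
  assumes "finite I" "\<And>i. f i \<in> borel_measurable borel" "\<And>i t. 0 \<le> f i t"
  shows "(\<integral>\<^sup>+ x. (\<Prod>i\<in>I. f i (x i)) \<partial>noise) = (\<Prod>i\<in>I. \<integral>\<^sup>+ t. std_normal_density t * f i t \<partial>lborel)"
proof -
  interpret prob_space noise by (rule noise_prob_space)
  have "indep_vars (\<lambda>_. borel) (\<lambda>i x. ennreal (f i (x i))) I"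
    by (rule indep_vars_compose2[OF indep_vars_subset[OF indep_vars_noise]]) (use assms in auto)
  then have "(\<integral>\<^sup>+ x. (\<Prod>i\<in>I. ennreal (f i (x i))) \<partial>noise) = (\<Prod>i\<in>I. \<integral>\<^sup>+ x. f i (x i) \<partial>noise)"
    using assms by (intro indep_vars_nn_integral) auto
  then show ?thesis
    using assms by (simp add: prod_ennreal nn_integral_noise_component)
qed

lemma nn_integral_normal_density:
  assumes "0 < \<sigma>"
  shows "(\<integral>\<^sup>+ t. normal_density \<mu> \<sigma> t \<partial>lborel) = 1"
  using assms by (subst nn_integral_eq_integral) (auto simp: normal_density_nonneg)

text \<open>The factor \<open>1 / 4\<close> leaves the quadratic coefficient of the exponent at
  \<open>- 1 / 4\<close>. Completing the square exhibits the integrand as a multiple of the normal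
  density with mean \<open>a\<close> and variance 2.\<close>

lemma gaussian_exp_quarter_square:
  "(\<integral>\<^sup>+ t. std_normal_density t * exp ((a + t)\<^sup>2 / 4) \<partial>lborel) = ennreal (sqrt 2 * exp (a\<^sup>2 / 2))"
proof -
  have "std_normal_density t * exp ((a + t)\<^sup>2 / 4)
      = (sqrt 2 * exp (a\<^sup>2 / 2)) * normal_density a (sqrt 2) t" for t
  proof -
    have "- t\<^sup>2 / 2 + (a + t)\<^sup>2 / 4 = a\<^sup>2 / 2 + - (t - a)\<^sup>2 / (2 * (sqrt 2)\<^sup>2)"
      by (simp add: power2_eq_square field_simps)
    then have "exp (- t\<^sup>2 / 2) * exp ((a + t)\<^sup>2 / 4) = exp (a\<^sup>2 / 2) * exp (- (t - a)\<^sup>2 / (2 * (sqrt 2)\<^sup>2))"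
      by (simp only: exp_add[symmetric])
    then show ?thesis
      by (simp add: normal_density_def real_sqrt_mult field_simps)
  qed
  then have "(\<integral>\<^sup>+ t. std_normal_density t * exp ((a + t)\<^sup>2 / 4) \<partial>lborel)
      = (\<integral>\<^sup>+ t. ennreal (sqrt 2 * exp (a\<^sup>2 / 2)) * normal_density a (sqrt 2) t \<partial>lborel)"
    by (simp add: ennreal_mult)
  also have "\<dots> = ennreal (sqrt 2 * exp (a\<^sup>2 / 2))"
    by (subst nn_integral_cmult) (auto simp: nn_integral_normal_density)
  finally show ?thesis .
qed

text \<open>Completing the square gives a normal density with mean \<open>- c * a / (1 + c)\<close>
  and variance \<open>1 / (1 + c)\<close>. Its prefactor \<open>\<sigma>\<close> is at most 1, and
  \<open>c \<le> 1\<close> simplifies \<open>2 * (1 + c)\<close> to 4 in the remaining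
  exponent.\<close>

lemma gaussian_exp_neg_square_le:
  assumes "0 \<le> c" "c \<le> 1"
  shows "(\<integral>\<^sup>+ t. std_normal_density t * exp (- (c * (a + t)\<^sup>2 / 2)) \<partial>lborel) \<le> ennreal (exp (- (c * a\<^sup>2 / 4)))"
proof -
  define \<sigma> where "\<sigma> = 1 / sqrt (1 + c)"
  define \<mu> where "\<mu> = - (c * a / (1 + c))"
  have s: "0 < \<sigma>" "\<sigma> \<le> 1" "\<sigma>\<^sup>2 = 1 / (1 + c)" using assms by (auto simp: \<sigma>_def power_divide)
  have "std_normal_density t * exp (- (c * (a + t)\<^sup>2 / 2))
      = (\<sigma> * exp (- (c * a\<^sup>2 / (2 * (1 + c))))) * normal_density \<mu> \<sigma> t" for t
  proof -
    have "- t\<^sup>2 / 2 + - (c * (a + t)\<^sup>2 / 2) = - (c * a\<^sup>2 / (2 * (1 + c))) + - (t - \<mu>)\<^sup>2 / (2 * \<sigma>\<^sup>2)"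
      unfolding s \<mu>_def using assms by (simp add: power2_eq_square divide_simps) algebra
    then have "exp (- t\<^sup>2 / 2) * exp (- (c * (a + t)\<^sup>2 / 2)) = exp (- (c * a\<^sup>2 / (2 * (1 + c)))) * exp (- (t - \<mu>)\<^sup>2 / (2 * \<sigma>\<^sup>2))"
      by (simp only: exp_add[symmetric])
    then show ?thesis
      using s(1) by (simp add: normal_density_def real_sqrt_mult)
  qed
  then have "(\<integral>\<^sup>+ t. std_normal_density t * exp (- (c * (a + t)\<^sup>2 / 2)) \<partial>lborel)
      = (\<integral>\<^sup>+ t. ennreal (\<sigma> * exp (- (c * a\<^sup>2 / (2 * (1 + c))))) * normal_density \<mu> \<sigma> t \<partial>lborel)"
    using s by (simp add: ennreal_mult)
  also have "\<dots> = ennreal (\<sigma> * exp (- (c * a\<^sup>2 / (2 * (1 + c)))))"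
    using s by (subst nn_integral_cmult) (auto simp: nn_integral_normal_density)
  also have "\<dots> \<le> ennreal (exp (- (c * a\<^sup>2 / 4)))"
  proof (rule ennreal_leI)
    have "c * a\<^sup>2 / 4 \<le> c * a\<^sup>2 / (2 * (1 + c))"
      using assms by (intro divide_left_mono) auto
    then have "exp (- (c * a\<^sup>2 / (2 * (1 + c)))) \<le> exp (- (c * a\<^sup>2 / 4))" by simp
    then show "\<sigma> * exp (- (c * a\<^sup>2 / (2 * (1 + c)))) \<le> exp (- (c * a\<^sup>2 / 4))"
      using mult_mono[of \<sigma> 1] s by auto
  qed
  finally show ?thesis .
qed

lemma nn_integral_noise_power2: "(\<integral>\<^sup>+ x. ennreal ((x j)\<^sup>2) \<partial>noise) = 1"
proof -
  have "(\<integral>\<^sup>+ x. ennreal ((x j)\<^sup>2) \<partial>noise) = (\<integral>\<^sup>+ t. std_normal_density t * t\<^sup>2 \<partial>lborel)"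
    by (rule nn_integral_noise_component) measurable
  also have "\<dots> = ennreal 1"
    using std_normal_moment_even[of 1]
    by (subst nn_integral_eq_integral) (auto simp: normal_density_nonneg has_bochner_integral_iff fact_numeral)
  finally show ?thesis by simp
qed

lemma nn_integral_noise_power4: "(\<integral>\<^sup>+ x. ennreal ((x j) ^ 4) \<partial>noise) = 3"
proof -
  have "(\<integral>\<^sup>+ x. ennreal ((x j) ^ 4) \<partial>noise) = (\<integral>\<^sup>+ t. std_normal_density t * t ^ 4 \<partial>lborel)"
    by (rule nn_integral_noise_component) measurable
  also have "\<dots> = ennreal 3"
    using std_normal_moment_even[of 2] 
    by (subst nn_integral_eq_integral) (auto simp: normal_density_nonneg has_bochner_integral_iff fact_numeral)
  finally show ?thesis by simp
qed

subsection \<open>The posterior for a fixed noise level\<close>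

lemma Lam_pos: "lam j \<noteq> 0 \<Longrightarrow> 0 < Lam lam j"
  by (simp add: Lam_def)

lemma Lam_le_LamMax: "1 \<le> j \<Longrightarrow> j \<le> m \<Longrightarrow> Lam lam j \<le> LamMax lam m"
  unfolding LamMax_def by (intro Max_ge) auto

text \<open>Dimension 1 qualifies because \<open>eps < 1\<close>, so the maximum runs over a
  nonempty finite set and is attained.\<close>

lemma Gdim_mem:
  assumes "0 < eps" "eps < 1"
  shows "Gdim lam eps \<in> {m \<in> {1..nat \<lfloor>1 / eps\<rfloor>}. eps * LamMax lam m \<le> Lam lam 1}"
  unfolding Gdim_def
proof (rule Max_in)
  have "1 \<le> nat \<lfloor>1 / eps\<rfloor>" using assms by (simp add: le_nat_iff le_floor_iff)
  moreover have "eps * LamMax lam 1 \<le> Lam lam 1"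
    using assms by (simp add: LamMax_def Lam_def divide_right_mono)
  ultimately show "{m \<in> {1..nat \<lfloor>1 / eps\<rfloor>}. eps * LamMax lam m \<le> Lam lam 1} \<noteq> {}"
    by auto
qed simp

lemma Gdim_ge_1: "0 < eps \<Longrightarrow> eps < 1 \<Longrightarrow> 1 \<le> Gdim lam eps"
  using Gdim_mem[of eps lam] by simp

lemma Gdim_le_inverse:
  assumes "0 < eps" "eps < 1"
  shows "real (Gdim lam eps) \<le> 1 / eps"
  using Gdim_mem[OF assms, of lam] assms by (auto simp: le_nat_iff le_floor_iff)

text \<open>The dimension cap is made for this: no coordinate that the prior can activate has more
  than a constant noise variance.\<close>

lemma eps_Lam_le_Lam_1:
  assumes "0 < eps" "eps < 1" "1 \<le> j" "j \<le> Gdim lam eps"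
  shows "eps * Lam lam j \<le> Lam lam 1"
proof -
  have "eps * Lam lam j \<le> eps * LamMax lam (Gdim lam eps)"
    using assms by (intro mult_left_mono Lam_le_LamMax) auto
  then show ?thesis using Gdim_mem[OF assms(1,2), of lam] by simp
qed

text \<open>One noise level is fixed, and Assumption A is kept only as the inequality at this level.
  The sign or size of \<open>C\<close> is stated in the lemmas that rely on it.\<close>

locale bayes_model =
  fixes lam th eta :: "nat \<Rightarrow> real" and tau :: "real \<Rightarrow> nat \<Rightarrow> real" and d C eps :: real
  assumes lam_nz: "\<And>j. 1 \<le> j \<Longrightarrow> lam j \<noteq> 0"
    and diff_l2: "in_l2 (\<lambda>j. th j - eta j)"
    and eps_pos: "0 < eps" and eps_less_1: "eps < 1"
    and d_pos: "0 < d"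
    and tau_pos: "\<And>j. 1 \<le> j \<Longrightarrow> 0 < tau eps j"
    and tau_ge: "\<And>j. 1 \<le> j \<Longrightarrow> j \<le> Gdim lam eps \<Longrightarrow>
      d * max (sqrt eps * sqrt (Lam lam j)) (eps * Lam lam j) \<le> tau eps j"
begin

abbreviation "G \<equiv> Gdim lam eps"

abbreviation "B \<equiv> sq_norm (\<lambda>j. th j - eta j)"

text \<open>The weight of the direct estimate \<open>Y j / lam j\<close> in the posterior mean of
  coordinate \<open>j\<close>; the rest of the weight lies on the prior mean.\<close>

definition shrink :: "nat \<Rightarrow> real" where
  "shrink j = 1 / (1 + eps * Lam lam j / tau eps j)"

text \<open>The observation, centred at \<open>lam j * eta j\<close> and divided by its standard
  deviation, is \<open>signal j + xi j\<close>.\<close>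

definition signal :: "nat \<Rightarrow> real" where
  "signal j = lam j * (th j - eta j) / sqrt eps"

definition posterior :: "(nat \<Rightarrow> real) \<Rightarrow> nat \<Rightarrow> real" where
  "posterior xi = post lam eta tau eps C (obs lam th eps xi)"

lemma shrink_bounds:
  assumes "1 \<le> j"
  shows "0 < shrink j" "shrink j \<le> 1"
  using assms lam_nz[OF assms] tau_pos[OF assms] eps_pos Lam_pos[of lam j]
  by (auto simp: shrink_def divide_simps add_pos_pos)

text \<open>The second term in the maximum of Assumption A bounds the ratio of noise variance to
  prior variance by \<open>1 / d\<close>.\<close>

lemma shrink_ge:
  assumes "1 \<le> j" "j \<le> G"
  shows "d / (1 + d) \<le> shrink j"
proof -
  have "d * (eps * Lam lam j) \<le> d * max (sqrt eps * sqrt (Lam lam j)) (eps * Lam lam j)"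
    using d_pos by (intro mult_left_mono) auto
  then have "d * (eps * Lam lam j) \<le> tau eps j" using tau_ge[OF assms] by linarith
  then have "eps * Lam lam j / tau eps j \<le> 1 / d"
    using d_pos tau_pos[OF assms(1)] by (simp add: field_simps)
  moreover have "0 < eps * Lam lam j / tau eps j"
    using eps_pos Lam_pos[of lam j] lam_nz tau_pos assms(1) by simp
  ultimately have "1 / (1 + 1 / d) \<le> shrink j"
    unfolding shrink_def using d_pos by (intro divide_left_mono) (auto intro!: mult_pos_pos add_pos_pos)
  moreover have "1 / (1 + 1 / d) = d / (1 + d)" using d_pos by (simp add: field_simps)
  ultimately show ?thesis by simp
qed

lemma thetaY_eq:
  assumes "1 \<le> j"
  shows "thetaY lam eta tau eps (obs lam th eps xi) j = eta j + shrink j * (th j - eta j + sqrt eps * xi j / lam j)"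
proof -
  have nz: "lam j \<noteq> 0" "tau eps j > 0" "eps > 0" using lam_nz tau_pos eps_pos assms by auto
  then have p: "lam j ^ 2 * tau eps j + eps > 0" by (intro add_nonneg_pos) auto
  have sg: "sigma lam tau eps j = eps * tau eps j / (lam j ^ 2 * tau eps j + eps)"
    using nz by (simp add: sigma_def field_simps)
  have sh: "shrink j = lam j ^ 2 * tau eps j / (lam j ^ 2 * tau eps j + eps)"
    using nz by (simp add: shrink_def Lam_def field_simps)
  show ?thesis
    unfolding thetaY_def obs_def sg sh using nz p
    by (simp add: divide_simps) (simp add: algebra_simps power2_eq_square)
qed

text \<open>Since \<open>shrink j * eps = (lam j)\<^sup>2 * sigma lam tau eps j\<close>, division by
  \<open>sigma\<close> removes one of the two shrinkage factors of the squared deviation.\<close>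

lemma sigma_norm_sq_thetahat:
  "sigma_norm_sq lam tau eps (\<lambda>j. thetahat_m lam eta tau eps m (obs lam th eps xi) j - eta j)
    = (\<Sum>j=1..m. shrink j * (signal j + xi j)\<^sup>2)"
proof -
  have eq: "(thetahat_m lam eta tau eps m (obs lam th eps xi) j - eta j)\<^sup>2 / sigma lam tau eps j
      = (if j \<le> m then shrink j * (signal j + xi j)\<^sup>2 else 0)" if "1 \<le> j" for j
  proof (cases "j \<le> m")
    case True
    have nz: "lam j \<noteq> 0" "tau eps j > 0" "eps > 0" using lam_nz tau_pos eps_pos that by auto
    then have p: "lam j ^ 2 * tau eps j + eps > 0" by (intro add_nonneg_pos) auto
    have sg: "shrink j * eps = (lam j)\<^sup>2 * sigma lam tau eps j" "sigma lam tau eps j > 0"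
      using nz p by (auto simp: shrink_def sigma_def Lam_def field_simps intro!: add_pos_pos)
    have "th j - eta j + sqrt eps * xi j / lam j = sqrt eps / lam j * (signal j + xi j)"
      using nz by (simp add: signal_def field_simps)
    then have "(thetahat_m lam eta tau eps m (obs lam th eps xi) j - eta j)\<^sup>2 / sigma lam tau eps j
        = (shrink j * eps) / ((lam j)\<^sup>2 * sigma lam tau eps j) * (shrink j * (signal j + xi j)\<^sup>2)"
      using True nz by (simp add: thetahat_m_def thetaY_eq[OF that] power_mult_distrib power_divide power2_eq_square[of "shrink j"])
    also have "\<dots> = shrink j * (signal j + xi j)\<^sup>2"
      unfolding sg(1) using sg(2) nz by simp
    finally show ?thesis using True by simp
  qed (simp add: thetahat_m_def)
  have "sigma_norm_sq lam tau eps (\<lambda>j. thetahat_m lam eta tau eps m (obs lam th eps xi) j - eta j)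
      = (\<Sum>i. if Suc i \<le> m then shrink (Suc i) * (signal (Suc i) + xi (Suc i))\<^sup>2 else 0)"
    unfolding sigma_norm_sq_def by (simp add: eq)
  also have "\<dots> = (\<Sum>i<m. if Suc i \<le> m then shrink (Suc i) * (signal (Suc i) + xi (Suc i))\<^sup>2 else 0)"
    by (rule suminf_finite) auto
  also have "\<dots> = (\<Sum>i<m. shrink (Suc i) * (signal (Suc i) + xi (Suc i))\<^sup>2)"
    by (intro sum.cong) auto
  also have "\<dots> = (\<Sum>j=1..m. shrink j * (signal j + xi j)\<^sup>2)"
    by (rule sum.reindex_bij_witness[of _ "\<lambda>j. j - 1" Suc]) auto
  finally show ?thesis .
qed

section \<open>Posterior probabilities of the dimension\<close>

lemma post_weight_eq:
  "post_weight lam eta tau eps C (obs lam th eps xi) m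
    = exp (((\<Sum>j=1..m. shrink j * (signal j + xi j)\<^sup>2) - 3 * C * real m) / 2)"
  unfolding post_weight_def sigma_norm_sq_thetahat ..

lemma post_weight_pos: "0 < post_weight lam eta tau eps C Y m"
  by (simp add: post_weight_def)

lemma posterior_nonneg: "0 \<le> posterior xi m"
  unfolding posterior_def post_def by (intro divide_nonneg_nonneg sum_nonneg less_imp_le post_weight_pos)

lemma sum_posterior: "(\<Sum>m=1..G. posterior xi m) = 1"
proof -
  have "(\<Sum>k=1..G. post_weight lam eta tau eps C (obs lam th eps xi) k) > 0"
    using Gdim_ge_1[OF eps_pos eps_less_1] by (intro sum_pos post_weight_pos) auto
  then show ?thesis by (simp add: posterior_def post_def sum_divide_distrib[symmetric])
qed

text \<open>Only the term of the reference dimension \<open>k\<close> is kept in the normalising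
  sum.\<close>

lemma posterior_le_ratio:
  assumes "1 \<le> k" "k \<le> G"
  shows "posterior xi m \<le> post_weight lam eta tau eps C (obs lam th eps xi) m
    / post_weight lam eta tau eps C (obs lam th eps xi) k"
proof -
  have "post_weight lam eta tau eps C (obs lam th eps xi) k
      \<le> (\<Sum>k=1..G. post_weight lam eta tau eps C (obs lam th eps xi) k)"
    using assms by (intro member_le_sum less_imp_le post_weight_pos) auto
  then show ?thesis
    unfolding posterior_def post_def using post_weight_pos
    by (intro divide_left_mono mult_pos_pos less_imp_le[OF post_weight_pos])
       (auto intro: less_le_trans)
qed

lemma posterior_le_1:
  assumes "1 \<le> m" "m \<le> G"
  shows "posterior xi m \<le> 1"
  using posterior_le_ratio[OF assms, of xi m] post_weight_pos[of "obs lam th eps xi" m] by simp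

text \<open>In the ratio to the weight of \<open>mo\<close> the squares up to \<open>m\<close>
  cancel. Those between \<open>m\<close> and \<open>mo\<close> remain with a negative sign, and the
  two penalties differ by at most the full penalty of \<open>mo\<close>.\<close>

lemma posterior_below_le:
  assumes "m \<le> mo" "1 \<le> mo" "mo \<le> G" "0 \<le> C"
  shows "posterior xi m \<le> exp (3 * C * real mo / 2)
    * (\<Prod>j\<in>{m<..mo}. exp (- (d / (1 + d) * (signal j + xi j)\<^sup>2 / 2)))"
proof -
  let ?q = "\<lambda>j. (signal j + xi j)\<^sup>2"
  define k where "k = d / (1 + d)"
  have "{1..mo} = {1..m} \<union> {m<..mo}" using assms by auto
  then have split: "(\<Sum>j=1..mo. shrink j * ?q j) = (\<Sum>j=1..m. shrink j * ?q j) + (\<Sum>j\<in>{m<..mo}. shrink j * ?q j)"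
    by (simp only:) (rule sum.union_disjoint, auto)
  have "(\<Sum>j\<in>{m<..mo}. k * ?q j) \<le> (\<Sum>j\<in>{m<..mo}. shrink j * ?q j)"
    using assms by (intro sum_mono mult_right_mono shrink_ge[folded k_def]) auto
  moreover have "0 \<le> 3 * C * real m" using assms by simp
  moreover have "(a - x) / 2 - (a + b - y) / 2 \<le> y / 2 + - (c / 2)" if "c \<le> b" "0 \<le> x" for a b c x y :: real
    using that by argo
  ultimately have le: "((\<Sum>j=1..m. shrink j * ?q j) - 3 * C * real m) / 2
      - ((\<Sum>j=1..mo. shrink j * ?q j) - 3 * C * real mo) / 2
      \<le> 3 * C * real mo / 2 + (\<Sum>j\<in>{m<..mo}. - (k * ?q j / 2))"
    unfolding split sum_negf sum_divide_distrib[symmetric] by blast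
  have "posterior xi m \<le> exp (((\<Sum>j=1..m. shrink j * ?q j) - 3 * C * real m) / 2
      - ((\<Sum>j=1..mo. shrink j * ?q j) - 3 * C * real mo) / 2)"
    using posterior_le_ratio[OF assms(2,3), of xi m] by (simp only: post_weight_eq exp_diff)
  also have "\<dots> \<le> exp (3 * C * real mo / 2 + (\<Sum>j\<in>{m<..mo}. - (k * ?q j / 2)))"
    using le by simp
  also have "\<dots> = exp (3 * C * real mo / 2) * (\<Prod>j\<in>{m<..mo}. exp (- (k * ?q j / 2)))"
    by (simp only: exp_add exp_sum[OF finite_greaterThanAtMost])
  finally show ?thesis unfolding k_def .
qed

text \<open>The square root is taken because the exponential moment of half a squared Gaussian is infinite.\<close>

lemma posterior_above_le:
  assumes "mo \<le> m" "1 \<le> mo" "m \<le> G"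
  shows "posterior xi m \<le> exp (- (3 * C * (real m - real mo) / 4))
    * (\<Prod>j\<in>{mo<..m}. exp ((signal j + xi j)\<^sup>2 / 4))"
proof -
  let ?q = "\<lambda>j. (signal j + xi j)\<^sup>2"
  define r where "r = ((\<Sum>j=1..m. shrink j * ?q j) - 3 * C * real m) / 2
      - ((\<Sum>j=1..mo. shrink j * ?q j) - 3 * C * real mo) / 2"
  have "{1..m} = {1..mo} \<union> {mo<..m}" using assms by auto
  then have split: "(\<Sum>j=1..m. shrink j * ?q j) = (\<Sum>j=1..mo. shrink j * ?q j) + (\<Sum>j\<in>{mo<..m}. shrink j * ?q j)"
    by (simp only:) (rule sum.union_disjoint, auto)
  have "(\<Sum>j\<in>{mo<..m}. shrink j * ?q j) \<le> (\<Sum>j\<in>{mo<..m}. 1 * ?q j)"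
    using assms by (intro sum_mono mult_right_mono shrink_bounds) auto
  moreover have "((a + b - 3 * C * x) / 2 - (a - 3 * C * y) / 2) / 2 \<le> - (3 * C * (x - y) / 4) + c / 4"
    if "b \<le> c" for a b c x y :: real
    using that by (simp add: field_simps)
  ultimately have le: "r / 2 \<le> - (3 * C * (real m - real mo) / 4) + (\<Sum>j\<in>{mo<..m}. ?q j / 4)"
    unfolding r_def split sum_divide_distrib[symmetric] by simp
  have p: "posterior xi m \<le> exp r"
    using posterior_le_ratio[of mo xi m] assms by (simp only: post_weight_eq exp_diff r_def)
  \<comment> \<open>A probability bounded by \<open>exp r\<close> is at most the minimum of 1 and
    \<open>exp r\<close>, hence at most \<open>exp (r / 2)\<close> for either sign of
    \<open>r\<close>.\<close>
  have "posterior xi m \<le> exp (r / 2)"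
  proof (cases "r \<le> 0")
    case True
    then have "exp r \<le> exp (r / 2)" by simp
    then show ?thesis using p by linarith
  next
    case False
    then have "1 \<le> exp (r / 2)" by simp
    then show ?thesis using posterior_le_1[of m xi] assms by linarith
  qed
  also have "\<dots> \<le> exp (- (3 * C * (real m - real mo) / 4) + (\<Sum>j\<in>{mo<..m}. ?q j / 4))"
    using le by simp
  also have "\<dots> = exp (- (3 * C * (real m - real mo) / 4)) * (\<Prod>j\<in>{mo<..m}. exp (?q j / 4))"
    by (simp only: exp_add exp_sum[OF finite_greaterThanAtMost])
  finally show ?thesis .
qed

text \<open>The error splits into shrinkage bias and noise. The first term in the maximum of
  Assumption A gives \<open>1 - shrink j \<le> sqrt (eps * Lam lam j) / d\<close>, so the squared
  bias has the same order \<open>eps * Lam lam j\<close> as the noise.\<close>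

lemma thetaY_error_le:
  assumes "1 \<le> j" "j \<le> G"
  shows "(thetaY lam eta tau eps (obs lam th eps xi) j - th j)\<^sup>2
    \<le> 2 * (eps * Lam lam j) * ((th j - eta j)\<^sup>2 / d\<^sup>2 + (xi j)\<^sup>2)"
proof -
  let ?s = "shrink j" and ?e = "eps * Lam lam j" and ?D = "th j - eta j"
  have L: "0 < Lam lam j" "0 < tau eps j" using Lam_pos lam_nz tau_pos assms by auto
  then have e: "0 < ?e" using eps_pos by simp
  have "1 - ?s = (?e / tau eps j) / (1 + ?e / tau eps j)"
    using e L by (simp add: shrink_def field_simps)
  also have "\<dots> \<le> ?e / tau eps j" 
    using e L divide_left_mono[of 1 "1 + ?e / tau eps j" "?e / tau eps j"] by (simp add: add_pos_pos)
  also have "\<dots> \<le> ?e / (d * sqrt ?e)"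
  proof (intro divide_left_mono)
    have "d * sqrt ?e \<le> d * max (sqrt eps * sqrt (Lam lam j)) ?e"
      using d_pos by (intro mult_left_mono) (auto simp: real_sqrt_mult)
    then show "d * sqrt ?e \<le> tau eps j" using tau_ge[OF assms] by linarith
  qed (use e L d_pos in auto)
  also have "\<dots> = ?e / sqrt ?e / d" by simp
  also have "\<dots> = sqrt ?e / d" using e by (simp only: real_div_sqrt less_imp_le)
  finally have "(1 - ?s)\<^sup>2 \<le> (sqrt ?e / d)\<^sup>2"
    using shrink_bounds[OF assms(1)] by (intro power_mono) auto
  then have s1: "(1 - ?s)\<^sup>2 \<le> ?e / d\<^sup>2" using e by (simp add: power_divide)
  have s2: "?s\<^sup>2 \<le> 1" using shrink_bounds[OF assms(1)] by (simp add: power_le_one)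
  have eq: "thetaY lam eta tau eps (obs lam th eps xi) j - th j = - ((1 - ?s) * ?D) + ?s * (sqrt eps * xi j / lam j)"
    by (simp add: thetaY_eq[OF assms(1)] algebra_simps)
  have two: "(u + v)\<^sup>2 \<le> 2 * u\<^sup>2 + 2 * v\<^sup>2" for u v :: real
    using sum_squares_bound[of u v] by (simp add: power2_sum)
  have "(thetaY lam eta tau eps (obs lam th eps xi) j - th j)\<^sup>2
      \<le> 2 * ((1 - ?s)\<^sup>2 * ?D\<^sup>2) + 2 * (?s\<^sup>2 * (sqrt eps * xi j / lam j)\<^sup>2)"
    unfolding eq using two[of "- ((1 - ?s) * ?D)" "?s * (sqrt eps * xi j / lam j)"]
    by (simp only: power_mult_distrib power2_minus)
  also have "\<dots> \<le> 2 * (?e / d\<^sup>2 * ?D\<^sup>2) + 2 * (1 * (sqrt eps * xi j / lam j)\<^sup>2)"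
    using s1 s2 by (intro add_mono mult_left_mono mult_right_mono) auto
  also have "(sqrt eps * xi j / lam j)\<^sup>2 = ?e * (xi j)\<^sup>2"
    using eps_pos by (simp add: power_divide power_mult_distrib Lam_def)
  finally show ?thesis by (simp add: algebra_simps)
qed

subsection \<open>Risk bounds in terms of posterior tails\<close>

text \<open>Together with \<open>upper_tail\<close> a majorant of the posterior mass outside the
  window from \<open>gm\<close> to \<open>gp\<close>. Each summand is a product over independent
  coordinates, so its expectation factorises.\<close>

definition lower_tail :: "nat \<Rightarrow> nat \<Rightarrow> (nat \<Rightarrow> real) \<Rightarrow> real" where
  "lower_tail gm mo xi = (\<Sum>m\<in>{1..<gm}. exp (3 * C * real mo / 2)
    * (\<Prod>j\<in>{m<..mo}. exp (- (d / (1 + d) * (signal j + xi j)\<^sup>2 / 2))))"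

definition upper_tail :: "nat \<Rightarrow> nat \<Rightarrow> (nat \<Rightarrow> real) \<Rightarrow> real" where
  "upper_tail gp mo xi = (\<Sum>m\<in>{gp<..G}. exp (- (3 * C * (real m - real mo) / 4))
    * (\<Prod>j\<in>{mo<..m}. exp ((signal j + xi j)\<^sup>2 / 4)))"

text \<open>The free level \<open>x\<close> decouples the dependent factors in \<open>q * xi\<^sup>2 \<le> x * q + xi ^ 4 / x\<close> for \<open>0 \<le> q \<le> 1\<close>.\<close>

definition variance_bound :: "nat \<Rightarrow> nat \<Rightarrow> real \<Rightarrow> (nat \<Rightarrow> real) \<Rightarrow> nat \<Rightarrow> real" where
  "variance_bound gp mo x xi j =
    (if j \<le> gp then 2 * (eps * Lam lam j) * (B / d\<^sup>2 + (xi j)\<^sup>2)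
     else 2 * Lam lam 1 * ((B / d\<^sup>2 + x) * upper_tail gp mo xi + (xi j) ^ 4 / x))"

lemma tails_nonneg: "0 \<le> lower_tail gm mo xi" "0 \<le> upper_tail gp mo xi"
  unfolding lower_tail_def upper_tail_def by (auto intro!: sum_nonneg mult_nonneg_nonneg prod_nonneg)

lemma summable_diff: "summable (\<lambda>i. (th (Suc i) - eta (Suc i))\<^sup>2)"
  using diff_l2 by (simp add: in_l2_def)

lemma diff_sq_le:
  assumes "1 \<le> j"
  shows "(th j - eta j)\<^sup>2 \<le> B"
  using sum_le_suminf[OF summable_diff, of "{j - 1}"] assms by (simp add: sq_norm_def)

lemma B_nonneg: "0 \<le> B"
  using diff_sq_le[of 1] zero_le_power2[of "th 1 - eta 1"] by linarith

lemma variance_bound_nonneg: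
  assumes "1 \<le> j" "0 < x"
  shows "0 \<le> variance_bound gp mo x xi j"
  using tails_nonneg(2)[of gp mo xi] B_nonneg eps_pos Lam_pos[of lam j] Lam_pos[of lam 1] lam_nz assms
  unfolding variance_bound_def
  by (auto intro!: mult_nonneg_nonneg add_nonneg_nonneg divide_nonneg_nonneg)

text \<open>The indicator form puts the bias on the same index set as the other parts of the risk,
  so that the series can be added termwise.\<close>

lemma bias_sums: "(\<lambda>i. if m < Suc i then (th (Suc i) - eta (Suc i))\<^sup>2 else 0) sums bias th eta m"
proof -
  let ?f = "\<lambda>i. if m < Suc i then (th (Suc i) - eta (Suc i))\<^sup>2 else 0"
  have s: "summable ?f"
    by (rule summable_comparison_test'[OF summable_diff]) auto
  have "suminf ?f = bias th eta m"
    using suminf_split_initial_segment[OF s, of m] by (simp add: bias_def add.commute)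
  then show ?thesis using summable_sums[OF s] by simp
qed

lemma bias_nonneg: "0 \<le> bias th eta m"
  using sums_unique[OF bias_sums[of m]] sums_summable[OF bias_sums[of m]] by (auto intro!: suminf_nonneg)

text \<open>The error is a mixture: weight \<open>p\<close> of the dimensions below \<open>j\<close>
  on \<open>eta j\<close>, weight \<open>q\<close> of the others on \<open>thetaY\<close>. The
  weight \<open>p\<close> is bounded by the lower tail up to \<open>gm\<close>, the weight
  \<open>q\<close> by the upper tail beyond \<open>gp\<close>; elsewhere both are bounded by
  1.\<close>

lemma bayes_est_error_le:
  assumes "1 \<le> j" "gm \<le> mo" "mo \<le> gp" "1 \<le> mo" "mo \<le> G" "0 \<le> C" "0 < x"
  shows "(bayes_est lam eta tau eps C (obs lam th eps xi) j - th j)\<^sup>2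
    \<le> (if gm < j then (th j - eta j)\<^sup>2 else 0) + lower_tail gm mo xi * (th j - eta j)\<^sup>2
      + (if j \<le> G then variance_bound gp mo x xi j else 0)"
proof (cases "j \<le> G")
  case False
  then show ?thesis
    using assms tails_nonneg(1)[of gm mo xi] by (simp add: bayes_est_def power2_commute)
next
  case True
  define p where "p = (\<Sum>m\<in>{1..<j}. posterior xi m)"
  define q where "q = (\<Sum>m\<in>{j..G}. posterior xi m)"
  let ?D = "(th j - eta j)\<^sup>2"
  let ?E = "thetaY lam eta tau eps (obs lam th eps xi) j - th j"
  have pq0: "0 \<le> p" "0 \<le> q" unfolding p_def q_def by (auto intro!: sum_nonneg posterior_nonneg)
  have "{1..G} = {1..<j} \<union> {j..G}" using True assms(1) by auto
  then have pq1: "p + q = 1"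
    unfolding p_def q_def sum_posterior[of xi, symmetric]
    by (simp only:) (rule sum.union_disjoint[symmetric], auto)
  have "bayes_est lam eta tau eps C (obs lam th eps xi) j - th j = p * (eta j - th j) + q * ?E"
  proof -
    have "th j = (p + q) * th j" using pq1 by simp
    then show ?thesis
      using True by (simp add: bayes_est_def p_def q_def posterior_def algebra_simps)
  qed
  \<comment> \<open>Convexity of the square; the gap \<open>p * q * (u - v)\<^sup>2\<close> is the
    variance of a two-point law.\<close>
  moreover have "(p * u + q * v)\<^sup>2 \<le> p * u\<^sup>2 + q * v\<^sup>2" for u v
  proof -
    have q: "q = 1 - p" using pq1 by simp
    have "p * u\<^sup>2 + q * v\<^sup>2 - (p * u + q * v)\<^sup>2 = p * q * (u - v)\<^sup>2"
      unfolding q by (simp add: power2_eq_square algebra_simps)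
    moreover have "0 \<le> p * q * (u - v)\<^sup>2" using pq0 by simp
    ultimately show ?thesis by linarith
  qed
  ultimately have main: "(bayes_est lam eta tau eps C (obs lam th eps xi) j - th j)\<^sup>2 \<le> p * ?D + q * ?E\<^sup>2"
    by (metis power2_commute)
  have p: "p * ?D \<le> (if gm < j then ?D else 0) + lower_tail gm mo xi * ?D"
  proof (cases "gm < j")
    case True
    have "p * ?D \<le> 1 * ?D" using pq0 pq1 by (intro mult_right_mono) auto
    moreover have "0 \<le> lower_tail gm mo xi * ?D" using tails_nonneg by simp
    ultimately show ?thesis using True by (simp del: mult_1)
  next
    case False
    have "p \<le> (\<Sum>m\<in>{1..<gm}. posterior xi m)"
      unfolding p_def using False by (intro sum_mono2) (auto intro: posterior_nonneg)
    also have "\<dots> \<le> lower_tail gm mo xi"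
      unfolding lower_tail_def using assms by (intro sum_mono posterior_below_le) auto
    finally show ?thesis using False by (simp add: mult_right_mono)
  qed
  have D: "0 \<le> ?D" "?D / d\<^sup>2 \<le> B / d\<^sup>2" using diff_sq_le[OF assms(1)] by (auto intro: divide_right_mono)
  have e: "0 < eps * Lam lam j" using eps_pos Lam_pos lam_nz assms(1) by simp
  have E: "?E\<^sup>2 \<le> 2 * (eps * Lam lam j) * (B / d\<^sup>2 + (xi j)\<^sup>2)"
    using D e by (intro order_trans[OF thetaY_error_le[OF assms(1) True]] mult_left_mono) auto
  have "q * ?E\<^sup>2 \<le> variance_bound gp mo x xi j"
  proof (cases "j \<le> gp")
    case True
    have "q * ?E\<^sup>2 \<le> 1 * ?E\<^sup>2" using pq0 pq1 by (intro mult_right_mono) auto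
    then show ?thesis using E True by (simp add: variance_bound_def)
  next
    case False
    have "q \<le> (\<Sum>m\<in>{gp<..G}. posterior xi m)"
      unfolding q_def using False by (intro sum_mono2) (auto intro: posterior_nonneg)
    also have "\<dots> \<le> upper_tail gp mo xi"
      unfolding upper_tail_def using assms by (intro sum_mono posterior_above_le) auto
    finally have qV: "q \<le> upper_tail gp mo xi" .
    have "0 \<le> (B / d\<^sup>2 + (xi j)\<^sup>2)" using D B_nonneg by simp
    then have "2 * (eps * Lam lam j) * (B / d\<^sup>2 + (xi j)\<^sup>2) \<le> 2 * Lam lam 1 * (B / d\<^sup>2 + (xi j)\<^sup>2)"
      using eps_Lam_le_Lam_1[OF eps_pos eps_less_1 assms(1) True] by (intro mult_right_mono) auto
    then have "q * ?E\<^sup>2 \<le> q * (2 * Lam lam 1 * (B / d\<^sup>2 + (xi j)\<^sup>2))"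
      using E pq0 by (intro mult_left_mono) auto
    also have "\<dots> = 2 * Lam lam 1 * (q * (B / d\<^sup>2) + q * (xi j)\<^sup>2)" by (simp add: algebra_simps)
    also have "\<dots> \<le> 2 * Lam lam 1 * (upper_tail gp mo xi * (B / d\<^sup>2) + (x * upper_tail gp mo xi + (xi j) ^ 4 / x))"
    proof (intro mult_left_mono add_mono mult_right_mono)
      show "q * (xi j)\<^sup>2 \<le> x * upper_tail gp mo xi + (xi j) ^ 4 / x"
      \<comment> \<open>Small noise leaves the tail majorant as a factor; for large noise
        \<open>q\<close> is bounded by 1 and one power of \<open>(xi j)\<^sup>2 / x\<close> is
        gained.\<close>
      proof (cases "(xi j)\<^sup>2 \<le> x")
        case True
        have "q * (xi j)\<^sup>2 \<le> upper_tail gp mo xi * x"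
          using True qV pq0 by (intro mult_mono) auto
        moreover have "0 \<le> (xi j) ^ 4 / x" using assms by simp
        ultimately show ?thesis by (simp add: mult.commute)
      next
        case False
        have "q * (xi j)\<^sup>2 \<le> 1 * (xi j)\<^sup>2" using pq0 pq1 by (intro mult_right_mono) auto
        also have "\<dots> \<le> (xi j)\<^sup>2 * (xi j)\<^sup>2 / x"
          unfolding pos_le_divide_eq[OF assms(7)] mult_1 using False by (intro mult_left_mono) auto
        also have "\<dots> = (xi j) ^ 4 / x" by (simp add: power_add[symmetric])
        finally show ?thesis using tails_nonneg(2)[of gp mo xi] assms(7)
          by (smt (verit) mult_nonneg_nonneg)
      qed
    qed (use qV D B_nonneg Lam_pos[of lam 1] lam_nz in auto)
    also have "\<dots> = variance_bound gp mo x xi j"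
      using False by (simp add: variance_bound_def algebra_simps)
    finally show ?thesis .
  qed
  then show ?thesis using main p True by simp
qed

lemma sq_norm_error_le:
  assumes "gm \<le> mo" "mo \<le> gp" "1 \<le> mo" "mo \<le> G" "0 \<le> C" "0 < x"
  shows "sq_norm (\<lambda>j. bayes_est lam eta tau eps C (obs lam th eps xi) j - th j)
    \<le> bias th eta gm + lower_tail gm mo xi * B + (\<Sum>j=1..G. variance_bound gp mo x xi j)"
proof -
  let ?f = "\<lambda>i. (bayes_est lam eta tau eps C (obs lam th eps xi) (Suc i) - th (Suc i))\<^sup>2"
  let ?h = "\<lambda>i. if Suc i \<le> G then variance_bound gp mo x xi (Suc i) else 0"
  let ?g = "\<lambda>i. (if gm < Suc i then (th (Suc i) - eta (Suc i))\<^sup>2 else 0)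
    + lower_tail gm mo xi * (th (Suc i) - eta (Suc i))\<^sup>2 + ?h i"
  have "?h sums (\<Sum>i<G. ?h i)" by (rule sums_finite) auto
  also have "(\<Sum>i<G. ?h i) = (\<Sum>i<G. variance_bound gp mo x xi (Suc i))"
    by (intro sum.cong) auto
  also have "\<dots> = (\<Sum>j=1..G. variance_bound gp mo x xi j)"
    by (rule sum.reindex_bij_witness[of _ "\<lambda>j. j - 1" Suc]) auto
  finally have h: "?h sums (\<Sum>j=1..G. variance_bound gp mo x xi j)" .
  have g: "?g sums (bias th eta gm + lower_tail gm mo xi * B + (\<Sum>j=1..G. variance_bound gp mo x xi j))"
    by (intro sums_add bias_sums h sums_mult) (simp add: sq_norm_def summable_sums summable_diff)
  have le: "?f i \<le> ?g i" for i using assms by (intro bayes_est_error_le) auto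
  \<comment> \<open>\<open>sq_norm\<close> is the true squared norm only for a summable series, so
    domination by the convergent majorant comes before the comparison of sums.\<close>
  have "summable ?f"
    by (rule summable_comparison_test'[OF sums_summable[OF g]]) (use le in auto)
  then have "suminf ?f \<le> suminf ?g" by (intro suminf_le le sums_summable[OF g])
  then show ?thesis unfolding sums_unique[OF g] by (simp add: sq_norm_def)
qed

section \<open>Expectation of the risk bound and of the tails\<close>

lemma tails_measurable [measurable]:
  "lower_tail gm mo \<in> borel_measurable noise" "upper_tail gp mo \<in> borel_measurable noise"
  unfolding lower_tail_def upper_tail_def by measurable

text \<open>Integrated termwise, the pointwise bound needs only the second and fourth moments of the
  noise, which are 1 and 3. The window and the level \<open>x\<close> stay free.\<close>

lemma risk_le:
  assumes "gm \<le> mo" "mo \<le> gp" "1 \<le> mo" "mo \<le> G" "0 \<le> C" "0 < x"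
    and u: "0 \<le> u" "(\<integral>\<^sup>+ xi. lower_tail gm mo xi \<partial>noise) \<le> ennreal u"
    and v: "0 \<le> v" "(\<integral>\<^sup>+ xi. upper_tail gp mo xi \<partial>noise) \<le> ennreal v"
  shows "risk lam th eta tau C eps \<le> ennreal (bias th eta gm + u * B
    + (\<Sum>j=1..G. if j \<le> gp then 2 * (eps * Lam lam j) * (B / d\<^sup>2 + 1)
         else 2 * Lam lam 1 * ((B / d\<^sup>2 + x) * v + 3 / x)))"
proof -
  interpret N: prob_space noise by (rule noise_prob_space)
  define T where "T j = (if j \<le> gp then 2 * (eps * Lam lam j) * (B / d\<^sup>2 + 1)
         else 2 * Lam lam 1 * ((B / d\<^sup>2 + x) * v + 3 / x))" for j
  note bias0 = bias_nonneg[of gm]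
  have Bd: "0 \<le> B / d\<^sup>2" using B_nonneg by simp
  have T0: "0 \<le> T j" if "1 \<le> j" for j
    using that Bd v(1) assms(6) eps_pos Lam_pos[of lam j] Lam_pos[of lam 1] lam_nz unfolding T_def
    by (auto intro!: mult_nonneg_nonneg add_nonneg_nonneg)
  have T: "(\<integral>\<^sup>+ xi. variance_bound gp mo x xi j \<partial>noise) \<le> ennreal (T j)" if "1 \<le> j" for j
  proof (cases "j \<le> gp")
    case True
    have e: "0 \<le> 2 * (eps * Lam lam j)" using eps_pos Lam_pos[of lam j] lam_nz that by simp
    have "(\<integral>\<^sup>+ xi. variance_bound gp mo x xi j \<partial>noise)
        = (\<integral>\<^sup>+ xi. ennreal (2 * (eps * Lam lam j)) * (ennreal (B / d\<^sup>2) + ennreal ((xi j)\<^sup>2)) \<partial>noise)"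
      using True e Bd by (intro nn_integral_cong) (simp add: variance_bound_def ennreal_mult ennreal_plus)
    also have "\<dots> = ennreal (2 * (eps * Lam lam j)) * (ennreal (B / d\<^sup>2) + 1)"
      by (simp add: nn_integral_cmult nn_integral_add nn_integral_noise_power2 N.emeasure_space_1)
    also have "\<dots> = ennreal (T j)"
      using True e Bd by (simp add: T_def ennreal_mult ennreal_plus)
    finally show ?thesis by simp
  next
    case False
    have l: "0 \<le> 2 * Lam lam 1" using Lam_pos[of lam 1] lam_nz by simp
    have "(\<integral>\<^sup>+ xi. variance_bound gp mo x xi j \<partial>noise)
        = (\<integral>\<^sup>+ xi. ennreal (2 * Lam lam 1) * (ennreal (B / d\<^sup>2 + x) * ennreal (upper_tail gp mo xi)
            + ennreal (1 / x) * ennreal ((xi j) ^ 4)) \<partial>noise)"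
      using False l Bd tails_nonneg(2) assms(6)
      by (intro nn_integral_cong) (simp add: variance_bound_def flip: ennreal_mult ennreal_plus)
    also have "\<dots> = ennreal (2 * Lam lam 1) * (ennreal (B / d\<^sup>2 + x) * (\<integral>\<^sup>+ xi. upper_tail gp mo xi \<partial>noise)
            + ennreal (1 / x) * 3)"
      by (simp add: nn_integral_cmult nn_integral_add nn_integral_noise_power4)
    also have "\<dots> \<le> ennreal (2 * Lam lam 1) * (ennreal (B / d\<^sup>2 + x) * ennreal v + ennreal (1 / x) * ennreal 3)"
      using v(2) by (intro mult_left_mono add_mono) auto
    also have "\<dots> = ennreal (T j)"
      using False l Bd v(1) assms(6)
      by (simp add: T_def del: ennreal_numeral flip: ennreal_mult ennreal_plus)
    finally show ?thesis .
  qed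
  have vm: "(\<lambda>xi. variance_bound gp mo x xi j) \<in> borel_measurable noise" for j
    unfolding variance_bound_def by measurable
  have "risk lam th eta tau C eps \<le> (\<integral>\<^sup>+ xi. ennreal (bias th eta gm + lower_tail gm mo xi * B
      + (\<Sum>j=1..G. variance_bound gp mo x xi j)) \<partial>noise)"
    unfolding risk_def using assms by (intro nn_integral_mono ennreal_leI sq_norm_error_le)
  also have "\<dots> = (\<integral>\<^sup>+ xi. ennreal (bias th eta gm) + ennreal (lower_tail gm mo xi) * ennreal B
      + (\<Sum>j=1..G. ennreal (variance_bound gp mo x xi j)) \<partial>noise)"
  proof (intro nn_integral_cong)
    fix xi
    have v: "0 \<le> variance_bound gp mo x xi j" if "j \<in> {1..G}" for j
      using variance_bound_nonneg assms(6) that by simp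
    have "0 \<le> lower_tail gm mo xi * B" using tails_nonneg(1) B_nonneg by simp
    then show "ennreal (bias th eta gm + lower_tail gm mo xi * B + (\<Sum>j=1..G. variance_bound gp mo x xi j))
        = ennreal (bias th eta gm) + ennreal (lower_tail gm mo xi) * ennreal B
          + (\<Sum>j=1..G. ennreal (variance_bound gp mo x xi j))"
      using bias0 v tails_nonneg(1) B_nonneg
      by (simp only: sum_ennreal ennreal_plus add_nonneg_nonneg sum_nonneg ennreal_mult)
  qed
  also have "\<dots> = ennreal (bias th eta gm) + (\<integral>\<^sup>+ xi. lower_tail gm mo xi \<partial>noise) * ennreal B
      + (\<Sum>j=1..G. \<integral>\<^sup>+ xi. variance_bound gp mo x xi j \<partial>noise)"
    using vm by (simp add: nn_integral_add nn_integral_multc nn_integral_sum N.emeasure_space_1)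
  also have "\<dots> \<le> ennreal (bias th eta gm) + ennreal u * ennreal B + (\<Sum>j=1..G. ennreal (T j))"
    using u T by (intro add_mono mult_right_mono sum_mono order_refl) auto
  also have "\<dots> = ennreal (bias th eta gm + u * B + (\<Sum>j=1..G. T j))"
  proof -
    have "0 \<le> T j" if "j \<in> {1..G}" for j using T0 that by simp
    moreover have "0 \<le> u * B" using u(1) B_nonneg by simp
    ultimately show ?thesis
      using bias0 u(1) B_nonneg
      by (simp only: sum_ennreal ennreal_plus add_nonneg_nonneg sum_nonneg ennreal_mult)
  qed
  finally show ?thesis unfolding T_def .
qed

text \<open>The left side of the hypothesis is the exponent left in each summand after the
  coordinatewise Gaussian integration with \<open>c = d / (1 + d)\<close>.\<close>

lemma nn_integral_lower_tail_le:
  assumes "\<And>m. 1 \<le> m \<Longrightarrow> m < gm \<Longrightarrow> 3 * C * real mo / 2 - d / (1 + d) / 4 * (\<Sum>j\<in>{m<..mo}. (signal j)\<^sup>2) \<le> - s"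
  shows "(\<integral>\<^sup>+ xi. lower_tail gm mo xi \<partial>noise) \<le> ennreal (real gm * exp (- s))"
proof -
  define k where "k = d / (1 + d)"
  have k: "0 \<le> k" "k \<le> 1" using d_pos by (auto simp: k_def)
  let ?P = "\<lambda>m xi. \<Prod>j\<in>{m<..mo}. exp (- (k * (signal j + xi j)\<^sup>2 / 2))"
  have each: "(\<integral>\<^sup>+ xi. exp (3 * C * real mo / 2) * ?P m xi \<partial>noise) \<le> ennreal (exp (- s))"
    if "1 \<le> m" "m < gm" for m
  proof -
    have "(\<integral>\<^sup>+ xi. exp (3 * C * real mo / 2) * ?P m xi \<partial>noise)
        = ennreal (exp (3 * C * real mo / 2)) * (\<integral>\<^sup>+ xi. ?P m xi \<partial>noise)"
      by (subst nn_integral_cmult[symmetric]) (auto simp: ennreal_mult prod_nonneg)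
    also have "(\<integral>\<^sup>+ xi. ?P m xi \<partial>noise)
        = (\<Prod>j\<in>{m<..mo}. \<integral>\<^sup>+ t. std_normal_density t * exp (- (k * (signal j + t)\<^sup>2 / 2)) \<partial>lborel)"
      by (rule nn_integral_noise_prod[of _ "\<lambda>j t. exp (- (k * (signal j + t)\<^sup>2 / 2))"]) auto
    also have "\<dots> \<le> (\<Prod>j\<in>{m<..mo}. ennreal (exp (- (k * (signal j)\<^sup>2 / 4))))"
      using k by (intro prod_mono_ennreal gaussian_exp_neg_square_le)
    also have "\<dots> = ennreal (exp (\<Sum>j\<in>{m<..mo}. - (k * (signal j)\<^sup>2 / 4)))"
      by (simp add: prod_ennreal exp_sum)
    also have "ennreal (exp (3 * C * real mo / 2)) * \<dots>
        = ennreal (exp (3 * C * real mo / 2 + (\<Sum>j\<in>{m<..mo}. - (k * (signal j)\<^sup>2 / 4))))"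
      by (simp add: exp_add ennreal_mult)
    also have "(\<Sum>j\<in>{m<..mo}. - (k * (signal j)\<^sup>2 / 4)) = - (k / 4 * (\<Sum>j\<in>{m<..mo}. (signal j)\<^sup>2))"
      by (simp add: sum_negf sum_distrib_left)
    also have "ennreal (exp (3 * C * real mo / 2 + - (k / 4 * (\<Sum>j\<in>{m<..mo}. (signal j)\<^sup>2)))) \<le> ennreal (exp (- s))"
      using assms[OF that] by (intro ennreal_leI) (simp add: k_def)
    finally show ?thesis by (simp add: mult_left_mono)
  qed
  have "(\<integral>\<^sup>+ xi. lower_tail gm mo xi \<partial>noise) = (\<Sum>m\<in>{1..<gm}. \<integral>\<^sup>+ xi. exp (3 * C * real mo / 2) * ?P m xi \<partial>noise)"
    unfolding lower_tail_def k_def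
    by (subst nn_integral_sum[symmetric]) (auto simp: sum_ennreal prod_nonneg)
  also have "\<dots> \<le> (\<Sum>m\<in>{1..<gm}. ennreal (exp (- s)))" by (intro sum_mono each) auto
  also have "\<dots> = ennreal (real (gm - 1) * exp (- s))" by (simp add: ennreal_mult ennreal_of_nat_eq_real_of_nat)
  also have "\<dots> \<le> ennreal (real gm * exp (- s))" by (intro ennreal_leI mult_right_mono) auto
  finally show ?thesis .
qed

text \<open>Each extra coordinate costs a Gaussian factor \<open>sqrt 2 \<le> exp (1 / 2)\<close>,
  while the penalty contributes at most \<open>exp (- 3 / 4)\<close> since \<open>1 \<le> C\<close>.
  The net decay \<open>exp (- 1 / 4)\<close> per coordinate must beat the signal.\<close>

lemma nn_integral_upper_tail_le:
  assumes "1 \<le> C" "mo \<le> gp"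
    and "\<And>m. gp < m \<Longrightarrow> m \<le> G \<Longrightarrow> (\<Sum>j\<in>{mo<..m}. (signal j)\<^sup>2) / 2 - (real m - real mo) / 4 \<le> - s"
  shows "(\<integral>\<^sup>+ xi. upper_tail gp mo xi \<partial>noise) \<le> ennreal (real G * exp (- s))"
proof -
  let ?P = "\<lambda>m xi. \<Prod>j\<in>{mo<..m}. exp ((signal j + xi j)\<^sup>2 / 4)"
  let ?c = "\<lambda>m. - (3 * C * (real m - real mo) / 4)"
  have sqrt2: "sqrt 2 \<le> exp (1 / 2)"
  proof -
    have "(2::real) \<le> exp 1" using exp_ge_add_one_self[of 1] by simp
    also have "\<dots> = (exp (1 / 2))\<^sup>2" by (simp add: power2_eq_square flip: exp_add)
    finally show ?thesis by (intro real_le_lsqrt) auto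
  qed
  have each: "(\<integral>\<^sup>+ xi. exp (?c m) * ?P m xi \<partial>noise) \<le> ennreal (exp (- s))"
    if m: "gp < m" "m \<le> G" for m
  proof -
    have "(\<integral>\<^sup>+ xi. exp (?c m) * ?P m xi \<partial>noise)
        = ennreal (exp (?c m)) * (\<integral>\<^sup>+ xi. ?P m xi \<partial>noise)"
      by (subst nn_integral_cmult[symmetric]) (auto simp: ennreal_mult prod_nonneg)
    also have "(\<integral>\<^sup>+ xi. ?P m xi \<partial>noise)
        = (\<Prod>j\<in>{mo<..m}. \<integral>\<^sup>+ t. std_normal_density t * exp ((signal j + t)\<^sup>2 / 4) \<partial>lborel)"
      by (rule nn_integral_noise_prod[of _ "\<lambda>j t. exp ((signal j + t)\<^sup>2 / 4)"]) auto
    also have "\<dots> = ennreal (\<Prod>j\<in>{mo<..m}. sqrt 2 * exp ((signal j)\<^sup>2 / 2))"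
      by (simp only: gaussian_exp_quarter_square) (rule prod_ennreal, simp)
    also have "\<dots> \<le> ennreal (\<Prod>j\<in>{mo<..m}. exp (1 / 2 + (signal j)\<^sup>2 / 2))"
      using sqrt2 by (intro ennreal_leI prod_mono) (auto simp: exp_add)
    also have "(\<Prod>j\<in>{mo<..m}. exp (1 / 2 + (signal j)\<^sup>2 / 2)) = exp (\<Sum>j\<in>{mo<..m}. 1 / 2 + (signal j)\<^sup>2 / 2)"
      by (simp only: exp_sum[OF finite_greaterThanAtMost])
    also have "(\<Sum>j\<in>{mo<..m}. 1 / 2 + (signal j)\<^sup>2 / 2)
        = (real m - real mo) / 2 + (\<Sum>j\<in>{mo<..m}. (signal j)\<^sup>2) / 2"
      using m assms(2) by (simp add: sum.distrib sum_divide_distrib of_nat_diff)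
    finally have "(\<integral>\<^sup>+ xi. exp (?c m) * ?P m xi \<partial>noise)
      \<le> ennreal (exp (?c m)) * ennreal (exp ((real m - real mo) / 2 + (\<Sum>j\<in>{mo<..m}. (signal j)\<^sup>2) / 2))"
      by (simp add: mult_left_mono)
    also have "\<dots> = ennreal (exp (?c m + ((real m - real mo) / 2 + (\<Sum>j\<in>{mo<..m}. (signal j)\<^sup>2) / 2)))"
      by (simp only: exp_add) (simp add: ennreal_mult)
    also have "\<dots> \<le> ennreal (exp (- s))"
    proof (intro ennreal_leI)
      have "1 * (real m - real mo) \<le> C * (real m - real mo)"
        using m assms by (intro mult_right_mono) auto
      moreover have "3 * C * (real m - real mo) = 3 * (C * (real m - real mo))" by simp
      ultimately show "exp (?c m + ((real m - real mo) / 2 + (\<Sum>j\<in>{mo<..m}. (signal j)\<^sup>2) / 2)) \<le> exp (- s)"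
        unfolding exp_le_cancel_iff using assms(3)[OF m] by linarith
    qed
    finally show ?thesis .
  qed
  have "(\<integral>\<^sup>+ xi. upper_tail gp mo xi \<partial>noise) = (\<Sum>m\<in>{gp<..G}. \<integral>\<^sup>+ xi. exp (?c m) * ?P m xi \<partial>noise)"
    unfolding upper_tail_def
    by (subst nn_integral_sum[symmetric]) (auto simp: sum_ennreal prod_nonneg)
  also have "\<dots> \<le> (\<Sum>m\<in>{gp<..G}. ennreal (exp (- s)))" by (intro sum_mono each) auto
  also have "\<dots> = ennreal (real (G - gp) * exp (- s))" by (simp add: ennreal_mult ennreal_of_nat_eq_real_of_nat)
  also have "\<dots> \<le> ennreal (real G * exp (- s))" by (intro ennreal_leI mult_right_mono) auto
  finally show ?thesis .
qed

end

subsection \<open>The oracle dimension\<close>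

lemma LamBar_sum: "1 \<le> m \<Longrightarrow> real m * LamBar lam m = (\<Sum>j=1..m. Lam lam j)"
  by (simp add: LamBar_def)

lemma LamBar_le_LamMax:
  assumes "1 \<le> m"
  shows "LamBar lam m \<le> LamMax lam m"
proof -
  have "(\<Sum>j=1..m. Lam lam j) \<le> (\<Sum>j=1..m. LamMax lam m)"
    by (intro sum_mono Lam_le_LamMax) auto
  then show ?thesis using assms by (simp add: LamBar_def divide_le_eq mult.commute)
qed

text \<open>The first coordinate alone gives this variance. It makes the oracle value positive, and
  bounds it below uniformly for \<open>eps\<close> away from zero.\<close>

lemma Phi_ge_eps_Lam_1:
  assumes "\<forall>j\<ge>1. lam j \<noteq> 0" "0 < eps" "1 \<le> m"
  shows "eps * Lam lam 1 \<le> Phi lam th eta eps m"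
proof -
  have "Lam lam 1 \<le> (\<Sum>j=1..m. Lam lam j)"
    using assms Lam_pos by (intro member_le_sum) (auto intro: less_imp_le)
  then have "eps * Lam lam 1 \<le> eps * (\<Sum>j=1..m. Lam lam j)" using assms by simp
  then show ?thesis using LamBar_sum[OF assms(3), of lam]
    by (simp add: Phi_def mult.assoc le_max_iff_disj)
qed

text \<open>Boundedness of \<open>lam\<close> forces the variance part to grow at least linearly in
  \<open>m\<close>, so the minimum is attained on a finite range and the \<open>LEAST\<close> and
  \<open>INF\<close> of the definitions are genuine.\<close>

lemma mopt_minimises:
  assumes "\<exists>b. \<forall>j\<ge>1. \<bar>lam j\<bar> \<le> b" "\<forall>j\<ge>1. lam j \<noteq> 0" "0 < eps"
  shows "1 \<le> mopt lam th eta eps"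
    and "Phiopt lam th eta eps = Phi lam th eta eps (mopt lam th eta eps)"
    and "1 \<le> k \<Longrightarrow> Phiopt lam th eta eps \<le> Phi lam th eta eps k"
proof -
  let ?P = "Phi lam th eta eps"
  obtain b where b: "\<And>j. 1 \<le> j \<Longrightarrow> \<bar>lam j\<bar> \<le> b" using assms(1) by auto
  have "0 < \<bar>lam 1\<bar>" using assms(2) by simp
  then have b0: "0 < b" using b[of 1] by linarith
  have ge: "eps * (real m / b\<^sup>2) \<le> ?P m" if "1 \<le> m" for m
  proof -
    have "(\<Sum>j=1..m. 1 / b\<^sup>2) \<le> (\<Sum>j=1..m. Lam lam j)"
    proof (intro sum_mono)
      fix j assume "j \<in> {1..m}"
      then have "(lam j)\<^sup>2 \<le> b\<^sup>2" "lam j \<noteq> 0" using b[of j] assms(2) b0 by (auto intro: abs_le_square_iff[THEN iffD1])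
      then show "1 / b\<^sup>2 \<le> Lam lam j" unfolding Lam_def using b0 by (intro divide_left_mono) auto
    qed
    then have "real m / b\<^sup>2 \<le> (\<Sum>j=1..m. Lam lam j)" by simp
    then have "eps * (real m / b\<^sup>2) \<le> eps * (\<Sum>j=1..m. Lam lam j)" using assms(3) by (intro mult_left_mono) auto
    then show ?thesis using LamBar_sum[OF that, of lam] by (simp add: Phi_def mult.assoc le_max_iff_disj)
  qed
  \<comment> \<open>From \<open>N\<close> on, the linear lower bound exceeds the value at dimension
    1.\<close>
  obtain N where N: "?P 1 * b\<^sup>2 / eps < real N" using reals_Archimedean2 by blast
  have big: "?P 1 \<le> ?P m" if "max 1 N \<le> m" for m
  proof -
    have "?P 1 * b\<^sup>2 / eps \<le> real m" using N that by linarith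
    then have "?P 1 \<le> eps * (real m / b\<^sup>2)" using b0 assms(3) by (simp add: field_simps)
    then show ?thesis using ge[of m] that by simp
  qed
  obtain m where m: "m \<in> {1..max 1 N}" "\<And>k. k \<in> {1..max 1 N} \<Longrightarrow> ?P m \<le> ?P k"
  proof -
    have "Min (?P ` {1..max 1 N}) \<in> ?P ` {1..max 1 N}" by (intro Min_in) auto
    then obtain m where "Min (?P ` {1..max 1 N}) = ?P m" "m \<in> {1..max 1 N}" by (rule imageE)
    then show ?thesis using that[of m] by (metis Min_le finite_atLeastAtMost finite_imageI imageI)
  qed
  have "1 \<le> m \<and> (\<forall>k\<ge>1. ?P m \<le> ?P k)"
  proof (intro conjI allI impI)
    fix k :: nat assume "1 \<le> k"
    show "?P m \<le> ?P k"
    proof (cases "k \<le> max 1 N")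
      case False
      then have "?P 1 \<le> ?P k" by (intro big) simp
      then show ?thesis using m(2)[of 1] by simp
    qed (use m(2) \<open>1 \<le> k\<close> in simp)
  qed (use m(1) in simp)
  then have mo: "1 \<le> mopt lam th eta eps \<and> (\<forall>k\<ge>1. ?P (mopt lam th eta eps) \<le> ?P k)"
    unfolding mopt_def by (rule LeastI)
  then show "1 \<le> mopt lam th eta eps" by simp
  show eq: "Phiopt lam th eta eps = ?P (mopt lam th eta eps)"
    unfolding Phiopt_def using mo by (intro cInf_eq_minimum) auto
  show "Phiopt lam th eta eps \<le> ?P k" if "1 \<le> k"
    unfolding eq using mo that by simp
qed

lemma assumpE_D:
  assumes "assumpE lam C L" "\<forall>j\<ge>1. lam j \<noteq> 0" "1 \<le> k"
  shows "j > k \<Longrightarrow> (lam j)\<^sup>2 \<le> C / LamMax lam k"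
    and "1 \<le> l \<Longrightarrow> LamMax lam (k * l) \<le> LamMax lam k * LamMax lam l"
    and "LamMax lam k \<le> L * LamBar lam k"
proof -
  have e: "(\<forall>j>k. (lam j)^2 \<le> C * (Min ((\<lambda>i. (lam i)^2) ` {1..k})))"
      "Min ((\<lambda>i. (lam i)^2) ` {1..k}) = 1 / LamMax lam k"
      "LamMax lam k / LamBar lam k \<le> L"
    using assms(1,3) unfolding assumpE_def by blast+
  show "(lam j)\<^sup>2 \<le> C / LamMax lam k" if "j > k" using e(1,2) that by simp
  show "LamMax lam (k * l) \<le> LamMax lam k * LamMax lam l" if "1 \<le> l"
    using assms(1,3) that unfolding assumpE_def by blast
  have "0 < LamBar lam k"
    unfolding LamBar_def using assms(2,3) Lam_pos by (intro divide_pos_pos sum_pos) auto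
  then show "LamMax lam k \<le> L * LamBar lam k" using e(3) by (simp add: divide_le_eq)
qed

section \<open>Crude and oracle risk bounds\<close>

context bayes_model
begin

lemma bias_eq: "bias th eta m = B - (\<Sum>j=1..m. (th j - eta j)\<^sup>2)"
proof -
  have "(\<Sum>j=1..m. (th j - eta j)\<^sup>2) = (\<Sum>i<m. (th (Suc i) - eta (Suc i))\<^sup>2)"
    by (rule sum.reindex_bij_witness[of _ Suc "\<lambda>j. j - 1"]) auto
  then show ?thesis
    using suminf_split_initial_segment[OF summable_diff, of m] by (simp add: bias_def sq_norm_def)
qed

lemma sum_diff_sq:
  assumes "m \<le> n"
  shows "(\<Sum>j\<in>{m<..n}. (th j - eta j)\<^sup>2) = bias th eta m - bias th eta n"
proof -
  have "{1..n} = {1..m} \<union> {m<..n}" using assms by auto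
  then have "(\<Sum>j=1..n. (th j - eta j)\<^sup>2) = (\<Sum>j=1..m. (th j - eta j)\<^sup>2) + (\<Sum>j\<in>{m<..n}. (th j - eta j)\<^sup>2)"
    by (simp only:) (rule sum.union_disjoint, auto)
  then show ?thesis by (simp add: bias_eq)
qed

lemma signal_sq: "(signal j)\<^sup>2 = (lam j)\<^sup>2 * (th j - eta j)\<^sup>2 / eps"
  using eps_pos by (simp add: signal_def power_divide power_mult_distrib)

text \<open>For the window from 0 to \<open>G\<close> both tails are empty sums. What remains is the
  full bias and at most \<open>1 / eps\<close> coordinates of bounded variance.\<close>

lemma risk_le_crude:
  assumes "0 \<le> C"
  shows "risk lam th eta tau C eps \<le> ennreal (B + 2 * Lam lam 1 / eps * (B / d\<^sup>2 + 1))"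
proof -
  have G: "1 \<le> G" using Gdim_ge_1 eps_pos eps_less_1 by blast
  have Bd: "0 \<le> B / d\<^sup>2 + 1" using B_nonneg by (simp add: add_nonneg_nonneg)
  have "risk lam th eta tau C eps \<le> ennreal (bias th eta 0 + 0 * B
    + (\<Sum>j=1..G. if j \<le> G then 2 * (eps * Lam lam j) * (B / d\<^sup>2 + 1)
         else 2 * Lam lam 1 * ((B / d\<^sup>2 + 1) * 0 + 3 / 1)))"
    using assms G by (intro risk_le[where mo=1]) (auto simp: lower_tail_def upper_tail_def)
  also have "\<dots> = ennreal (B + (\<Sum>j=1..G. 2 * (eps * Lam lam j) * (B / d\<^sup>2 + 1)))"
    by (simp add: bias_eq)
  also have "\<dots> \<le> ennreal (B + 2 * Lam lam 1 / eps * (B / d\<^sup>2 + 1))"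
  proof (intro ennreal_leI add_mono order_refl)
    have "(\<Sum>j=1..G. 2 * (eps * Lam lam j) * (B / d\<^sup>2 + 1)) \<le> (\<Sum>j=1..G. 2 * Lam lam 1 * (B / d\<^sup>2 + 1))"
      using Bd eps_Lam_le_Lam_1[OF eps_pos eps_less_1] by (intro sum_mono mult_right_mono) auto
    also have "\<dots> = real G * (2 * Lam lam 1 * (B / d\<^sup>2 + 1))" by simp
    also have "\<dots> \<le> 1 / eps * (2 * Lam lam 1 * (B / d\<^sup>2 + 1))"
      using Gdim_le_inverse[OF eps_pos eps_less_1] Bd Lam_pos[of lam 1] lam_nz
      by (intro mult_right_mono mult_nonneg_nonneg) auto
    finally show "(\<Sum>j=1..G. 2 * (eps * Lam lam j) * (B / d\<^sup>2 + 1)) \<le> 2 * Lam lam 1 / eps * (B / d\<^sup>2 + 1)"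
      by simp
  qed
  finally show ?thesis .
qed

text \<open>The oracle quantities enter as numbers: \<open>\<Phi>\<close> for the oracle value,
  \<open>F\<close> for a bound on it, \<open>\<kappa>\<close> for the balance of Assumption O. The
  constant collects, in this order, the bias at the lower end of the window, the lower tail, the
  variance in the window and the variance beyond it; it contains neither \<open>eps\<close>,
  \<open>tau\<close> nor \<open>mo\<close>.\<close>

lemma risk_le_oracle:
  fixes R mo :: nat and \<Phi> \<kappa> F L :: real
  assumes E: "assumpE lam C L" and mo: "1 \<le> mo" "mo \<le> G"
    and \<Phi>: "0 < \<Phi>" "\<Phi> \<le> F" "bias th eta mo \<le> \<Phi>" "eps * (real mo * LamBar lam mo) \<le> \<Phi>"
    and \<kappa>: "0 < \<kappa>" "\<kappa> * \<Phi> \<le> eps * (real mo * LamBar lam mo)"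
    and G: "real G \<le> \<Phi> * exp (real mo)"
    and R: "1 \<le> R" "1 + 4 * (C / (2 * \<kappa>) + 4) \<le> real R"
  shows "risk lam th eta tau C eps \<le> ennreal ((1 + 4 * L * (3 * C / 2 + 1) / (d / (1 + d)) + B
    + 2 * (real R * LamMax lam R * L * (B / d\<^sup>2 + 1)) + 2 * Lam lam 1 * ((B / d\<^sup>2 + 1) * F + 3)) * \<Phi>)"
proof -
  have C: "1 \<le> C" "1 \<le> L" using E by (auto simp: assumpE_def)
  have nz: "\<forall>j\<ge>1. lam j \<noteq> 0" using lam_nz by simp
  note E1 = assumpE_D(1)[OF E nz] and E2 = assumpE_D(2)[OF E nz] and E3 = assumpE_D(3)[OF E nz]
  have L1: "0 < Lam lam 1" using Lam_pos lam_nz by simp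
  have Lmax: "0 < LamMax lam k" if "1 \<le> k" for k
    using Lam_le_LamMax[of 1 k lam] L1 that by simp
  define c where "c = d / (1 + d)"
  have c: "0 < c" using d_pos by (simp add: c_def)
  \<comment> \<open>Chosen so that a bias above \<open>Kb * \<Phi>\<close> yields
    \<open>c / 4\<close> times a signal of at least \<open>(3 * C / 2 + 1) * mo\<close>: this pays
    the penalty \<open>3 * C * mo / 2\<close> and leaves \<open>mo\<close>.\<close>
  define Kb where "Kb = 1 + 4 * L * (3 * C / 2 + 1) / c"
  have Kb: "1 \<le> Kb" using C c by (simp add: Kb_def)
  define gm where "gm = (LEAST m. bias th eta m \<le> Kb * \<Phi>)"
  have "1 * \<Phi> \<le> Kb * \<Phi>" using Kb \<Phi>(1) by (intro mult_right_mono) auto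
  then have ex: "bias th eta mo \<le> Kb * \<Phi>" using \<Phi>(3) by simp
  have gm: "bias th eta gm \<le> Kb * \<Phi>" "gm \<le> mo"
    unfolding gm_def using ex by (auto intro: LeastI Least_le)
  have gm': "Kb * \<Phi> < bias th eta m" if "m < gm" for m
    using not_less_Least[OF that[unfolded gm_def]] by simp
  \<comment> \<open>The exchange rate between squared bias and squared signal: the signal is at
    least \<open>1 / M\<close> times the bias increments up to \<open>mo\<close>, and at most
    \<open>C / M\<close> times them beyond. \<open>mo * M\<close> has the order of
    \<open>\<Phi>\<close>, from above by the constant \<open>L\<close> of Assumption E and from
    below by \<open>\<kappa>\<close>.\<close>
  define M where "M = eps * LamMax lam mo"
  have M0: "0 < M" using eps_pos Lmax[OF mo(1)] by (simp add: M_def)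
  have Mu: "real mo * M \<le> L * \<Phi>"
  proof -
    have "real mo * M \<le> real mo * (eps * (L * LamBar lam mo))"
      unfolding M_def using eps_pos E3[OF mo(1)] by (intro mult_left_mono) auto
    also have "\<dots> = L * (eps * (real mo * LamBar lam mo))" by simp
    also have "\<dots> \<le> L * \<Phi>" using \<Phi>(4) C by (intro mult_left_mono) auto
    finally show ?thesis .
  qed
  have Ml: "\<kappa> * \<Phi> \<le> real mo * M"
  proof -
    have "eps * (real mo * LamBar lam mo) \<le> eps * (real mo * LamMax lam mo)"
      using eps_pos LamBar_le_LamMax[OF mo(1)] by (intro mult_left_mono) auto
    then show ?thesis using \<kappa>(2) by (simp add: M_def mult.left_commute)
  qed
  have lower: "(\<integral>\<^sup>+ xi. lower_tail gm mo xi \<partial>noise) \<le> ennreal (real gm * exp (- real mo))"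
  proof (rule nn_integral_lower_tail_le)
    fix m assume m: "1 \<le> m" "m < gm"
    have "1 / M * (th j - eta j)\<^sup>2 \<le> (signal j)\<^sup>2" if "j \<in> {m<..mo}" for j
    proof -
      have j: "1 \<le> j" "j \<le> mo" "lam j \<noteq> 0" using that lam_nz by auto
      have "1 / LamMax lam mo \<le> 1 / Lam lam j"
        using Lam_le_LamMax[OF j(1,2), of lam] Lam_pos[where lam=lam and j=j, OF j(3)] Lmax[OF mo(1)] by (intro divide_left_mono) auto
      then have "1 / LamMax lam mo \<le> (lam j)\<^sup>2" by (simp add: Lam_def)
      then have "1 / LamMax lam mo * ((th j - eta j)\<^sup>2 / eps) \<le> (lam j)\<^sup>2 * ((th j - eta j)\<^sup>2 / eps)"
        using eps_pos by (intro mult_right_mono) auto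
      then show ?thesis by (simp add: signal_sq M_def mult.commute)
    qed
    then have "(\<Sum>j\<in>{m<..mo}. 1 / M * (th j - eta j)\<^sup>2) \<le> (\<Sum>j\<in>{m<..mo}. (signal j)\<^sup>2)"
      by (intro sum_mono)
    moreover have "(\<Sum>j\<in>{m<..mo}. 1 / M * (th j - eta j)\<^sup>2) = 1 / M * (bias th eta m - bias th eta mo)"
      using m gm(2) by (subst sum_distrib_left[symmetric], subst sum_diff_sq) auto
    moreover have "real mo * (4 * (3 * C / 2 + 1) / c) \<le> 1 / M * (bias th eta m - bias th eta mo)"
    proof -
      have "real mo * M * (4 * (3 * C / 2 + 1) / c) \<le> L * \<Phi> * (4 * (3 * C / 2 + 1) / c)"
        using Mu C c by (intro mult_right_mono) auto
      also have "\<dots> = (Kb - 1) * \<Phi>" by (simp add: Kb_def)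
      also have "\<dots> \<le> bias th eta m - bias th eta mo"
        using gm'[OF m(2)] \<Phi>(3) by (simp add: algebra_simps)
      finally show ?thesis using M0 by (simp add: field_simps)
    qed
    ultimately have "c / 4 * (real mo * (4 * (3 * C / 2 + 1) / c)) \<le> c / 4 * (\<Sum>j\<in>{m<..mo}. (signal j)\<^sup>2)"
      using c by (intro mult_left_mono) auto
    moreover have "c / 4 * (real mo * (4 * (3 * C / 2 + 1) / c)) = real mo * (3 * C / 2 + 1)"
      using c by (simp add: field_simps)
    ultimately have "real mo * (3 * C / 2 + 1) \<le> c / 4 * (\<Sum>j\<in>{m<..mo}. (signal j)\<^sup>2)"
      by (simp only:)
    then show "3 * C * real mo / 2 - d / (1 + d) / 4 * (\<Sum>j\<in>{m<..mo}. (signal j)\<^sup>2) \<le> - real mo"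
      unfolding c_def[symmetric] by (simp add: algebra_simps)
  qed
  \<comment> \<open>As a multiple of \<open>mo\<close>, the upper end lets submultiplicativity of
    \<open>LamMax\<close> bound every variance in the window by
    \<open>LamMax lam R * M\<close>.\<close>
  define gp where "gp = R * mo"
  have gp: "mo \<le> gp" using R(1) by (simp add: gp_def)
  have upper: "(\<integral>\<^sup>+ xi. upper_tail gp mo xi \<partial>noise) \<le> ennreal (real G * exp (- (4 * real mo)))"
  proof (rule nn_integral_upper_tail_le[OF C(1) gp])
    fix m assume m: "gp < m" "m \<le> G"
    \<comment> \<open>Half the signal energy beyond \<open>mo\<close> is at most
      \<open>q * mo\<close>. The choice of \<open>R\<close> gives
      \<open>(m - mo) / 4 \<ge> (q + 4) * mo\<close>, which leaves the decay
      \<open>4 * mo\<close>.\<close>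
    define q where "q = C / (2 * \<kappa>)"
    have "(signal j)\<^sup>2 \<le> C / M * (th j - eta j)\<^sup>2" if "j \<in> {mo<..m}" for j
    proof -
      have "(lam j)\<^sup>2 \<le> C / LamMax lam mo" using E1[OF mo(1)] that by simp
      then have "(lam j)\<^sup>2 * ((th j - eta j)\<^sup>2 / eps) \<le> C / LamMax lam mo * ((th j - eta j)\<^sup>2 / eps)"
        using eps_pos by (intro mult_right_mono) auto
      then show ?thesis by (simp add: signal_sq M_def mult.commute)
    qed
    then have "(\<Sum>j\<in>{mo<..m}. (signal j)\<^sup>2) \<le> (\<Sum>j\<in>{mo<..m}. C / M * (th j - eta j)\<^sup>2)"
      by (intro sum_mono)
    also have "\<dots> = C / M * (bias th eta mo - bias th eta m)"
      using m gp by (subst sum_distrib_left[symmetric], subst sum_diff_sq) auto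
    also have "\<dots> \<le> C / M * \<Phi>"
      using \<Phi>(3) bias_nonneg[of m] C M0 by (intro mult_left_mono) auto
    also have "\<dots> \<le> C * real mo / \<kappa>"
    proof -
      have "C * (\<kappa> * \<Phi>) \<le> C * (real mo * M)" using Ml C by (intro mult_left_mono) auto
      then show ?thesis using M0 \<kappa>(1) by (simp add: field_simps)
    qed
    finally have "(\<Sum>j\<in>{mo<..m}. (signal j)\<^sup>2) / 2 \<le> q * real mo" by (simp add: q_def)
    moreover have "4 * (q + 4) * real mo \<le> (real R - 1) * real mo"
      using R(2) by (intro mult_right_mono) (auto simp: q_def)
    moreover have "real R * real mo \<le> real m"
      using m(1) unfolding gp_def by (metis less_imp_le of_nat_le_iff of_nat_mult)
    ultimately show "(\<Sum>j\<in>{mo<..m}. (signal j)\<^sup>2) / 2 - (real m - real mo) / 4 \<le> - (4 * real mo)"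
      by (simp add: algebra_simps)
  qed
  \<comment> \<open>Half of the decay exponent \<open>4 * mo\<close> is spent on \<open>x\<close>.
    Then \<open>G * x * v\<close> is the square of \<open>G * exp (- mo)\<close>, which is at most
    \<open>\<Phi>\<close>, and \<open>1 / x\<close> is still at most
    \<open>exp (- mo)\<close>.\<close>
  define x where "x = exp (2 * real mo)"
  define v where "v = real G * exp (- (4 * real mo))"
  define u where "u = real gm * exp (- real mo)"
  have Bd: "0 \<le> B / d\<^sup>2" using B_nonneg by simp
  have x1: "1 \<le> x" by (simp add: x_def)
  have v0: "0 \<le> v" by (simp add: v_def)
  have Ge: "real G * exp (- real mo) \<le> \<Phi>" using G by (simp add: exp_minus field_simps)
  have uB: "u * B \<le> B * \<Phi>"
  proof -
    have "u \<le> real G * exp (- real mo)" unfolding u_def using gm(2) mo(2) by (intro mult_right_mono) auto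
    then show ?thesis using Ge B_nonneg mult_right_mono[of u \<Phi> B] by (simp add: mult.commute)
  qed
  have S1: "(\<Sum>j=1..gp. 2 * (eps * Lam lam j) * (B / d\<^sup>2 + 1)) \<le> 2 * (real R * LamMax lam R * L * (B / d\<^sup>2 + 1)) * \<Phi>"
  proof -
    have "(\<Sum>j=1..gp. 2 * (eps * Lam lam j) * (B / d\<^sup>2 + 1))
        \<le> (\<Sum>j=1..gp. 2 * (LamMax lam R * M) * (B / d\<^sup>2 + 1))"
    proof (intro sum_mono mult_right_mono mult_left_mono)
      fix j assume "j \<in> {1..gp}"
      then have "Lam lam j \<le> LamMax lam (R * mo)" unfolding gp_def by (intro Lam_le_LamMax) auto
      also have "\<dots> \<le> LamMax lam R * LamMax lam mo" using E2 R(1) mo(1) by simp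
      finally have "eps * Lam lam j \<le> eps * (LamMax lam R * LamMax lam mo)" using eps_pos by simp
      then show "eps * Lam lam j \<le> LamMax lam R * M" by (simp add: M_def mult.left_commute)
    qed (use Bd in auto)
    also have "\<dots> = 2 * (real R * LamMax lam R * (B / d\<^sup>2 + 1)) * (real mo * M)" by (simp add: gp_def)
    also have "\<dots> \<le> 2 * (real R * LamMax lam R * (B / d\<^sup>2 + 1)) * (L * \<Phi>)"
      using Mu Bd Lmax[OF R(1)] by (intro mult_left_mono) auto
    finally show ?thesis by (simp add: mult_ac)
  qed
  have S2: "real G * (2 * Lam lam 1 * ((B / d\<^sup>2 + x) * v + 3 / x)) \<le> 2 * Lam lam 1 * ((B / d\<^sup>2 + 1) * F + 3) * \<Phi>"
  proof -
    have "B / d\<^sup>2 * 1 \<le> B / d\<^sup>2 * x" using x1 Bd by (intro mult_left_mono) auto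
    then have "B / d\<^sup>2 + x \<le> (B / d\<^sup>2 + 1) * x" by (simp add: algebra_simps)
    then have "(B / d\<^sup>2 + x) * v \<le> (B / d\<^sup>2 + 1) * x * v" using v0 by (rule mult_right_mono)
    then have "real G * ((B / d\<^sup>2 + x) * v) \<le> real G * ((B / d\<^sup>2 + 1) * x * v)" by (rule mult_left_mono) simp
    also have "\<dots> = (B / d\<^sup>2 + 1) * (real G * exp (- real mo))\<^sup>2"
    proof -
      have "x * exp (- (4 * real mo)) = (exp (- real mo))\<^sup>2"
        by (simp add: x_def power2_eq_square flip: exp_add)
      then have "x * v = real G * (exp (- real mo))\<^sup>2" by (simp add: v_def mult.left_commute)
      then show ?thesis by (simp add: mult.assoc mult.left_commute power_mult_distrib power2_eq_square[of "real G"])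
    qed
    also have "\<dots> \<le> (B / d\<^sup>2 + 1) * (F * \<Phi>)"
    proof (intro mult_left_mono)
      have "(real G * exp (- real mo))\<^sup>2 \<le> \<Phi>\<^sup>2" using Ge by (intro power_mono) auto
      \<comment> \<open>The surplus power of \<open>\<Phi>\<close> is absorbed by its uniform bound
        \<open>F\<close>.\<close>
      also have "\<dots> \<le> F * \<Phi>" using \<Phi>(1,2) by (simp add: power2_eq_square)
      finally show "(real G * exp (- real mo))\<^sup>2 \<le> F * \<Phi>" .
    qed (use Bd in auto)
    finally have a: "real G * ((B / d\<^sup>2 + x) * v) \<le> (B / d\<^sup>2 + 1) * (F * \<Phi>)" .
    have "exp (real mo) \<le> x" by (simp add: x_def)
    then have "3 / x \<le> 3 / exp (real mo)" using x1 by (intro divide_left_mono) auto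
    then have "real G * (3 / x) \<le> real G * (3 / exp (real mo))" by (rule mult_left_mono) simp
    also have "\<dots> = 3 * (real G * exp (- real mo))" by (simp add: exp_minus field_simps)
    finally have b: "real G * (3 / x) \<le> 3 * \<Phi>" using Ge by simp
    have "2 * Lam lam 1 * (real G * ((B / d\<^sup>2 + x) * v) + real G * (3 / x))
        \<le> 2 * Lam lam 1 * ((B / d\<^sup>2 + 1) * (F * \<Phi>) + 3 * \<Phi>)"
      using a b L1 by (intro mult_left_mono add_mono) auto
    then show ?thesis by (simp add: algebra_simps)
  qed
  have "risk lam th eta tau C eps \<le> ennreal (bias th eta gm + u * B
    + (\<Sum>j=1..G. if j \<le> gp then 2 * (eps * Lam lam j) * (B / d\<^sup>2 + 1)
         else 2 * Lam lam 1 * ((B / d\<^sup>2 + x) * v + 3 / x)))"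
    using gm(2) gp mo C x1 lower upper by (intro risk_le) (auto simp: u_def v_def)
  also have "\<dots> \<le> ennreal (Kb * \<Phi> + B * \<Phi> + (2 * (real R * LamMax lam R * L * (B / d\<^sup>2 + 1)) * \<Phi>
      + 2 * Lam lam 1 * ((B / d\<^sup>2 + 1) * F + 3) * \<Phi>))"
  proof (intro ennreal_leI add_mono gm uB)
    let ?a = "\<lambda>j. 2 * (eps * Lam lam j) * (B / d\<^sup>2 + 1)" and ?b = "2 * Lam lam 1 * ((B / d\<^sup>2 + x) * v + 3 / x)"
    have a0: "0 \<le> ?a j" if "1 \<le> j" for j
      using that eps_pos Lam_pos[of lam j] lam_nz Bd by simp
    have b0: "0 \<le> ?b" using L1 Bd x1 v0 by simp
    have "(\<Sum>j=1..G. if j \<le> gp then ?a j else ?b) \<le> (\<Sum>j=1..G. (if j \<le> gp then ?a j else 0) + ?b)"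
      using b0 by (intro sum_mono) auto
    also have "\<dots> = (\<Sum>j=1..G. if j \<le> gp then ?a j else 0) + real G * ?b"
      by (simp add: sum.distrib)
    also have "(\<Sum>j=1..G. if j \<le> gp then ?a j else 0) = (\<Sum>j\<in>{1..G} \<inter> {j. j \<le> gp}. ?a j)"
      by (simp add: sum.inter_restrict)
    also have "\<dots> \<le> (\<Sum>j=1..gp. ?a j)" using a0 by (intro sum_mono2) auto
    finally show "(\<Sum>j=1..G. if j \<le> gp then ?a j else ?b)
        \<le> 2 * (real R * LamMax lam R * L * (B / d\<^sup>2 + 1)) * \<Phi> + 2 * Lam lam 1 * ((B / d\<^sup>2 + 1) * F + 3) * \<Phi>"
      using S1 S2 by linarith
  qed
  finally show ?thesis by (simp add: Kb_def c_def distrib_right add.assoc)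
qed

end

section \<open>A constant uniform in the noise level and the prior variances\<close>

theorem mainTheorem14:
  fixes lam th eta :: "nat \<Rightarrow> real" and d C L eps_o :: real
  assumes lam_bdd: "\<exists>B. \<forall>j\<ge>1. \<bar>lam j\<bar> \<le> B"
    and lam_nz: "\<forall>j\<ge>1. lam j \<noteq> 0"
    and th_l2: "in_l2 th"
    and diff_l2: "in_l2 (\<lambda>j. th j - eta j)"
    and eps_o: "0 < eps_o" "eps_o < 1"
    and d_pos: "d > 0"
    and E: "assumpE lam C L"
    and O: "assumpO lam th eta eps_o"
    and lim: "((\<lambda>eps. ln (real (Gdim lam eps) / Phiopt lam th eta eps) / real (mopt lam th eta eps))
                 \<longlongrightarrow> 0) (at_right 0)"
  shows "\<exists>K::real. \<forall>(tau :: real \<Rightarrow> nat \<Rightarrow> real) eps_th.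
           (\<forall>eps\<in>{0<..<1}. \<forall>j\<ge>1. tau eps j > 0) \<longrightarrow> assumpA lam tau d \<longrightarrow>
           0 < eps_th \<longrightarrow> eps_th < 1 \<longrightarrow>
           (\<forall>eps\<in>{0<..<eps_th}. mopt lam th eta eps \<le> Gdim lam eps) \<longrightarrow>
           (\<forall>eps\<in>{0<..<eps_th}. risk lam th eta tau C eps \<le> ennreal (K * Phiopt lam th eta eps))"
proof -
  let ?mo = "mopt lam th eta" and ?\<Phi> = "Phiopt lam th eta" and ?G = "Gdim lam"
  let ?B = "sq_norm (\<lambda>j. th j - eta j)"
  let ?V = "\<lambda>eps. eps * real (?mo eps) * LamBar lam (?mo eps)"
  note mo = mopt_minimises[OF lam_bdd lam_nz, where th=th and eta=eta]
  have C: "1 \<le> C" "1 \<le> L" using E by (auto simp: assumpE_def)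
  have L1: "0 < Lam lam 1" using Lam_pos lam_nz by simp
  have \<Phi>_ge: "eps * Lam lam 1 \<le> ?\<Phi> eps" if "0 < eps" for eps
    using Phi_ge_eps_Lam_1[OF lam_nz that] mo[OF that] by simp
  have \<Phi>_pos: "0 < ?\<Phi> eps" if "0 < eps" for eps
    using \<Phi>_ge[OF that] L1 that by (meson less_le_trans mult_pos_pos)
  have le_\<Phi>: "bias th eta (?mo eps) \<le> ?\<Phi> eps" "?V eps \<le> ?\<Phi> eps" if "0 < eps" for eps
    using mo(2)[OF that] by (auto simp: Phi_def)
  \<comment> \<open>Comparison with dimension 1 bounds the oracle value for all
    \<open>eps < 1\<close> at once.\<close>
  define F where "F = max (bias th eta 1) (Lam lam 1)"
  have \<Phi>_le: "?\<Phi> eps \<le> F" if "0 < eps" "eps < 1" for eps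
  proof -
    have "eps * Lam lam 1 \<le> 1 * Lam lam 1" using that L1 by (intro mult_right_mono) auto
    then have "Phi lam th eta eps 1 \<le> F" by (auto simp: Phi_def F_def LamBar_def)
    then show ?thesis using mo(3)[OF that(1), of 1] by simp
  qed
  let ?r = "\<lambda>eps. inverse (?\<Phi> eps) * min (bias th eta (?mo eps)) (?V eps)"
  define \<kappa> where "\<kappa> = (INF eps\<in>{0<..<eps_o}. ?r eps)"
  have \<kappa>: "0 < \<kappa>" using O by (simp add: \<kappa>_def assumpO_def)
  have bias0: "0 \<le> bias th eta m" for m
  proof -
    have "summable (\<lambda>i. (th (i + m + 1) - eta (i + m + 1))\<^sup>2)"
      using diff_l2 summable_iff_shift[of "\<lambda>i. (th (Suc i) - eta (Suc i))\<^sup>2" m] by (simp add: in_l2_def)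
    then show ?thesis unfolding bias_def by (intro suminf_nonneg) auto
  qed
  have \<kappa>_le: "\<kappa> * ?\<Phi> eps \<le> ?V eps" if "0 < eps" "eps < eps_o" for eps
  proof -
    have "0 \<le> ?r e" if "e \<in> {0<..<eps_o}" for e
    proof -
      have e: "0 < e" using that by simp
      have "0 \<le> LamBar lam (?mo e)"
        unfolding LamBar_def by (intro divide_nonneg_nonneg sum_nonneg) (auto simp: Lam_def)
      then show ?thesis using \<Phi>_pos[OF e] e bias0 by simp
    qed
    \<comment> \<open>A real infimum is a lower bound only if the set is bounded below;
      nonnegativity of the ratio ensures this.\<close>
    then have "bdd_below (?r ` {0<..<eps_o})" by (intro bdd_belowI[of _ 0]) auto
    then have "\<kappa> \<le> ?r eps" unfolding \<kappa>_def using that by (intro cINF_lower) auto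
    then have "\<kappa> * ?\<Phi> eps \<le> min (bias th eta (?mo eps)) (?V eps)"
      using \<Phi>_pos[OF that(1)] by (simp add: field_simps)
    then show ?thesis by simp
  qed
  \<comment> \<open>From the limit only an eventual bound by 1 is taken: it says that
    \<open>Gdim\<close> is at most \<open>Phiopt * exp mopt\<close>.\<close>
  have "\<forall>\<^sub>F eps in at_right 0. ln (real (?G eps) / ?\<Phi> eps) / real (?mo eps) < 1"
    using lim by (rule order_tendstoD) simp
  then obtain e1 where e1: "0 < e1"
    "\<And>eps. 0 < eps \<Longrightarrow> eps < e1 \<Longrightarrow> ln (real (?G eps) / ?\<Phi> eps) / real (?mo eps) < 1"
    unfolding eventually_at_right_field by auto
  define e2 where "e2 = min e1 eps_o"
  have e2: "0 < e2" using e1(1) eps_o by (simp add: e2_def)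
  obtain R :: nat where R: "1 + 4 * (C / (2 * \<kappa>) + 4) \<le> real R" using real_arch_simple by blast
  have "0 \<le> C / (2 * \<kappa>)" using C \<kappa> by simp
  then have R1: "1 \<le> R" using R by (cases R) auto
  \<comment> \<open>\<open>K1\<close> serves \<open>eps < e2\<close> and \<open>K2\<close> serves
    \<open>e2 \<le> eps\<close>. Both are fixed before \<open>tau\<close> and \<open>eps_th\<close>
    enter, as the order of quantifiers demands.\<close>
  define K1 where "K1 = 1 + 4 * L * (3 * C / 2 + 1) / (d / (1 + d)) + ?B
    + 2 * (real R * LamMax lam R * L * (?B / d\<^sup>2 + 1)) + 2 * Lam lam 1 * ((?B / d\<^sup>2 + 1) * F + 3)"
  \<comment> \<open>The crude risk bound at \<open>e2\<close>, divided by the lower bound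
    \<open>e2 * Lam lam 1\<close> of the oracle value for \<open>e2 \<le> eps\<close>.\<close>
  define K2 where "K2 = (?B + 2 * Lam lam 1 / e2 * (?B / d\<^sup>2 + 1)) / (e2 * Lam lam 1)"
  have main: "risk lam th eta tau C eps \<le> ennreal (max K1 K2 * ?\<Phi> eps)"
    if tau: "\<forall>eps\<in>{0<..<1}. \<forall>j\<ge>1. tau eps j > 0" and A: "assumpA lam tau d"
      and eps: "0 < eps" "eps < 1" "?mo eps \<le> ?G eps" for tau eps
  proof -
    interpret bayes_model lam th eta tau d C eps
      by unfold_locales (use lam_nz diff_l2 eps d_pos tau A in \<open>auto simp: assumpA_def\<close>)
    have small: "risk lam th eta tau C eps \<le> ennreal (K1 * ?\<Phi> eps)" if "eps < e2"
      unfolding K1_def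
    proof (rule risk_le_oracle[OF E _ _ _ _ _ _ \<kappa> _ _ R1 R])
      have "0 < real (?mo eps)" using mo(1)[OF eps(1)] by simp
      then have "ln (real (?G eps) / ?\<Phi> eps) < real (?mo eps)"
        using e1(2)[OF eps(1)] that by (simp add: e2_def divide_less_eq)
      moreover have "0 < real (?G eps) / ?\<Phi> eps"
        using \<Phi>_pos[OF eps(1)] Gdim_ge_1[OF eps(1,2), of lam] by simp
      ultimately have "real (?G eps) / ?\<Phi> eps \<le> exp (real (?mo eps))"
        by (metis exp_ln exp_le_cancel_iff less_imp_le)
      then show "real (?G eps) \<le> ?\<Phi> eps * exp (real (?mo eps))"
        using \<Phi>_pos[OF eps(1)] by (simp add: divide_le_eq mult.commute)
    qed (use eps mo(1) \<Phi>_pos \<Phi>_le le_\<Phi>[OF eps(1)] \<kappa>_le[OF eps(1)] that in \<open>auto simp: mult.assoc e2_def\<close>)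
    have large: "risk lam th eta tau C eps \<le> ennreal (K2 * ?\<Phi> eps)" if "e2 \<le> eps"
    proof -
      have Bd: "0 \<le> ?B / d\<^sup>2 + 1" using B_nonneg by (simp add: add_nonneg_nonneg)
      have "2 * Lam lam 1 / eps * (?B / d\<^sup>2 + 1) \<le> 2 * Lam lam 1 / e2 * (?B / d\<^sup>2 + 1)"
        using that e2 L1 Bd by (intro mult_right_mono divide_left_mono) auto
      then have "risk lam th eta tau C eps \<le> ennreal (?B + 2 * Lam lam 1 / e2 * (?B / d\<^sup>2 + 1))"
        using C by (intro order_trans[OF risk_le_crude] ennreal_leI) auto
      also have "\<dots> = ennreal (K2 * (e2 * Lam lam 1))" using e2 L1 by (simp add: K2_def)
      also have "\<dots> \<le> ennreal (K2 * ?\<Phi> eps)"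
      proof (intro ennreal_leI mult_left_mono)
        have "e2 * Lam lam 1 \<le> eps * Lam lam 1" using that L1 by simp
        then show "e2 * Lam lam 1 \<le> ?\<Phi> eps" using \<Phi>_ge[OF eps(1)] by simp
        show "0 \<le> K2" unfolding K2_def using e2 L1 Bd B_nonneg by simp
      qed
      finally show ?thesis .
    qed
    have le: "ennreal (k * ?\<Phi> eps) \<le> ennreal (max K1 K2 * ?\<Phi> eps)" if "k \<le> max K1 K2" for k
      using that \<Phi>_pos[OF eps(1)] by (intro ennreal_leI mult_right_mono) auto
    show ?thesis
    proof (cases "eps < e2")
      case True
      then show ?thesis using small le[of K1] by (meson max.cobounded1 order_trans)
    next
      case False
      then show ?thesis using large le[of K2] by (meson max.cobounded2 not_less order_trans)
    qed
  qed
  show ?thesis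
  proof (intro exI[of _ "max K1 K2"] allI impI ballI)
    fix tau :: "real \<Rightarrow> nat \<Rightarrow> real" and eps_th eps :: real
    assume "\<forall>eps\<in>{0<..<1}. \<forall>j\<ge>1. tau eps j > 0" "assumpA lam tau d" "eps_th < 1"
      "\<forall>eps\<in>{0<..<eps_th}. ?mo eps \<le> ?G eps" "eps \<in> {0<..<eps_th}"
    then show "risk lam th eta tau C eps \<le> ennreal (max K1 K2 * ?\<Phi> eps)"
      by (intro main) auto
  qed
qed

end
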